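(* Let $\mathbb K\in\{\mathbb R,\mathbb C,\mathbb H,\mathbb O\}$ and $k:=\dim_{\mathbb R}\mathbb K-1$. Let $\Pi:S^d\to\Sigma$ be either (i) the $\mathbb K$-projective map $\Pi_{\mathbb K}:S^{(k+1)n+k}\subset\mathbb K^{n+1}\to\mathbb{KP}^n$, $\omega\mapsto[\omega]$, for some $n\in\mathbb N$ (with $n=1$ if $\mathbb K=\mathbb O$), so that $d=(k+1)n+k$ and $\Sigma=\mathbb{KP}^n$; or (ii) the $\mathbb K$-Hopf map $\pi_{\mathbb K}:S^{2k+1}\subset\mathbb K^2\to S^{k+1}\subset\mathbb R\times\mathbb K$, $(a,b)\mapsto(|a|^2-|b|^2,\,2a\overline b)$, so that $d=2k+1$ and $\Sigma=S^{k+1}$. Let $(Y,\lambda_Y)$ be a weighted $0$-design on $\Sigma$ and, for each $y\in Y$, let $(Z_y,\lambda_y)$ be a weighted $0$-design on $S^k\subset\mathbb K$ and let $z_y\in\Pi^{-1}(y)$ be a base point. Define $$X:=\bigcup_{y\in Y}\{z_yz\mid z\in Z_y\},\qquad \lambda(z_yz):=\lambda_Y(y)\lambda_y(z)\quad\text{for } y\in Y,\ z\in Z_y.$$ Then for every $t\in\mathbb N$: (1) If $(X,\lambda)$ is a weighted $t$-design on $S^d$, then $(Y,\lambda_Y)$ is a weighted $\lfloor t/2\rfloor$-design on $\Sigma$. (2) If $(Y,\lambda_Y)$ is a weighted $\lfloor t/2\rfloor$-design on $\Sigma$ and $(Z_y,\lambda_y)$ is a weighted $t$-design on $S^k$ for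 each $y\in Y$, then $(X,\lambda)$ is a weighted $t$-design on $S^d$. (3) If $|Z_y|$ is constant in $y\in Y$, the corresponding statements for unweighted designs (weighted designs with constant weight function) hold: if $X$ is an unweighted $t$-design on $S^d$, then $Y$ is an unweighted $\lfloor t/2\rfloor$-design on $\Sigma$; and if $Y$ is an unweighted $\lfloor t/2\rfloor$-design on $\Sigma$ and each $Z_y$ is an unweighted $t$-design on $S^k$, then $X$ is an unweighted $t$-design on $S^d$.
   Context: $\mathbb N$ includes $0$. $\mathbb R,\mathbb C,\mathbb H,\mathbb O$ are the real numbers, complex numbers, quaternions and octonions, with their standard multiplication, conjugation and norm. $\mathbb K$ is identified with $\mathbb R^{k+1}$ via its standard basis, so $\mathbb K^{n+1}\cong\mathbb R^{(k+1)(n+1)}$; $S^m$ is the unit sphere in $\mathbb R^{m+1}$; in particular $S^k$ is the unit sphere of $\mathbb K$ and, for $d=(k+1)n+k$, $S^d$ is the unit sphere of $\mathbb K^{n+1}$. For $\omega\in\mathbb K^{n+1}$ and $\zeta\in\mathbb K$, $\omega\zeta$ denotes componentwise right multiplication. Projective space: $\mathbb{KP}^n:=\{[\omega]\mid\omega\in S^d\}$, $d=(k+1)n+k$, where $[\omega]\subset S^d$ is the set $\left\{\frac{(\omega\overline{\omega_{n+1}})\zeta}{|\omega_{n+1}|}\,\middle|\,\zeta\in S^k\right\}$ if $\omega_{n+1}\ne0$ and $\{\omega\zeta\mid\zeta\in S^k\}$ if $\omega_{n+1}=0$. (For $\mathbb K\in\{\mathbb R,\mathbb C,\mathbb H\}$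 this is simply $\{\omega\zeta\mid\zeta\in S^k\}$.) The fiber of $\Pi_{\mathbb K}$ over $w\in\mathbb{KP}^n$ is $w$ itself as a subset of $S^d$. Measures: $\sigma$ is the uniform (rotation-invariant) probability measure on $S^m$; $\rho$ is the uniform probability measure on $\mathbb{KP}^n$, which equals the pushforward $(\Pi_{\mathbb K})_*\sigma$. Polynomials: $P_t(\mathbb R^{m+1})$ is the space of real polynomials of degree at most $t$ on $\mathbb R^{m+1}$; $P_t(S^m):=\{f|_{S^m}\mid f\in P_t(\mathbb R^{m+1})\}$; $P_t(\mathbb{KP}^n):=\{f:\mathbb{KP}^n\to\mathbb R\mid f\circ\Pi_{\mathbb K}\in P_{2t}(S^d)\}$. Designs: for $(\Omega,\mu)$ equal to $(S^m,\sigma)$ or $(\mathbb{KP}^n,\rho)$, a pair $(X,\lambda)$ of a finite subset $X\subset\Omega$ and a function $\lambda:X\to\{r\in\mathbb R\mid r>0\}$ is a weighted $t$-design on $\Omega$ if $\sum_{x\in X}\lambda(x)f(x)=\int_\Omega f\,d\mu$ for all $f\in P_t(\Omega)$. $X$ is an unweighted $t$-design if this holds with $\lambda$ the constant function $|X|^{-1}$.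
   Formalization: For K = O the base points z_y are additionally required to satisfy z_yζ ∈ Π⁻¹(y) for all ζ in S^k; without this, non-associativity lets X leave the fibers over Y and the claim is false. For K = R, C, H nothing is added. *)

theory Defs
  imports "HOL-Probability.Probability"
begin

section \<open>Quaternions and octonions\<close>

(* Cayley-Dickson doubling.  Quat a b stands for a + b j, and Oct p q for p + q l, where
     (a, b)(c, d) = (a c - d* b, d a + b c* )   and   (a, b)* = (a*, -b). *)

datatype quaternion = Quat (quat_fst: complex) (quat_snd: complex)

instantiation quaternion :: euclidean_space
begin

definition "0 = Quat 0 0"
definition "p + q = Quat (quat_fst p + quat_fst q) (quat_snd p + quat_snd q)"
definition "- p = Quat (- quat_fst p) (- quat_snd p)"
definition "p - q = Quat (quat_fst p - quat_fst q) (quat_snd p - quat_snd q)"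
definition "r *\<^sub>R p = Quat (r *\<^sub>R quat_fst p) (r *\<^sub>R quat_snd p)"
definition "inner p q = inner (quat_fst p) (quat_fst q) + inner (quat_snd p) (quat_snd q)"
definition "norm (p :: quaternion) = sqrt (inner p p)"
definition "sgn (p :: quaternion) = inverse (norm p) *\<^sub>R p"
definition "dist (p :: quaternion) q = norm (p - q)"
definition [code del]: "(uniformity :: (quaternion \<times> quaternion) filter) =
  (INF e\<in>{0 <..}. principal {(p, q). dist p q < e})"
definition [code del]: "open (U :: quaternion set) \<longleftrightarrow>
  (\<forall>p\<in>U. eventually (\<lambda>(p', q). p' = p \<longrightarrow> q \<in> U) uniformity)"
definition "Basis = (\<lambda>b. Quat b 0) ` Basis \<union> Quat 0 ` Basis"

instance
proof
  fix p q r :: quaternion and s t :: real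
  show "p + q + r = p + (q + r)" "p + q = q + p" "0 + p = p" "- p + p = 0" "p - q = p + - q"
    by (simp_all add: plus_quaternion_def zero_quaternion_def uminus_quaternion_def
        minus_quaternion_def algebra_simps)
  show "s *\<^sub>R (p + q) = s *\<^sub>R p + s *\<^sub>R q" "(s + t) *\<^sub>R p = s *\<^sub>R p + t *\<^sub>R p"
    "s *\<^sub>R t *\<^sub>R p = (s * t) *\<^sub>R p" "1 *\<^sub>R p = p"
    by (simp_all add: plus_quaternion_def scaleR_quaternion_def algebra_simps)
  show "inner p q = inner q p" "inner (p + q) r = inner p r + inner q r"
    "inner (s *\<^sub>R p) q = s * inner p q" "0 \<le> inner p p"
    by (simp_all add: inner_quaternion_def plus_quaternion_def scaleR_quaternion_def
        inner_commute inner_add_left algebra_simps)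
  show "inner p p = 0 \<longleftrightarrow> p = 0"
    by (cases p) (simp add: inner_quaternion_def zero_quaternion_def add_nonneg_eq_0_iff)
  show "(Basis :: quaternion set) \<noteq> {}" "finite (Basis :: quaternion set)"
    by (simp_all add: Basis_quaternion_def)
  show "inner p q = (if p = q then 1 else 0)" if "p \<in> Basis" "q \<in> Basis"
    using that by (auto simp: Basis_quaternion_def inner_quaternion_def inner_Basis split: if_splits)
  show "(\<forall>q\<in>Basis. inner p q = 0) \<longleftrightarrow> p = 0"
    by (cases p) (simp add: Basis_quaternion_def inner_quaternion_def zero_quaternion_def
        ball_Un euclidean_all_zero_iff del: inner_complex_def Basis_complex_def)
qed (simp_all add: norm_quaternion_def sgn_quaternion_def dist_quaternion_def
      uniformity_quaternion_def open_quaternion_def)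

end

instantiation quaternion :: times
begin
definition "p * q = Quat
  (quat_fst p * quat_fst q - cnj (quat_snd q) * quat_snd p)
  (quat_snd q * quat_fst p + quat_snd p * cnj (quat_fst q))"
instance ..
end

definition quat_cnj :: "quaternion \<Rightarrow> quaternion" where
  "quat_cnj p = Quat (cnj (quat_fst p)) (- quat_snd p)"

datatype octonion = Oct (oct_fst: quaternion) (oct_snd: quaternion)

instantiation octonion :: euclidean_space
begin

definition "0 = Oct 0 0"
definition "x + y = Oct (oct_fst x + oct_fst y) (oct_snd x + oct_snd y)"
definition "- x = Oct (- oct_fst x) (- oct_snd x)"
definition "x - y = Oct (oct_fst x - oct_fst y) (oct_snd x - oct_snd y)"
definition "r *\<^sub>R x = Oct (r *\<^sub>R oct_fst x) (r *\<^sub>R oct_snd x)"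
definition "inner x y = inner (oct_fst x) (oct_fst y) + inner (oct_snd x) (oct_snd y)"
definition "norm (x :: octonion) = sqrt (inner x x)"
definition "sgn (x :: octonion) = inverse (norm x) *\<^sub>R x"
definition "dist (x :: octonion) y = norm (x - y)"
definition [code del]: "(uniformity :: (octonion \<times> octonion) filter) =
  (INF e\<in>{0 <..}. principal {(x, y). dist x y < e})"
definition [code del]: "open (U :: octonion set) \<longleftrightarrow>
  (\<forall>x\<in>U. eventually (\<lambda>(x', y). x' = x \<longrightarrow> y \<in> U) uniformity)"
definition "Basis = (\<lambda>b. Oct b 0) ` Basis \<union> Oct 0 ` Basis"

instance
proof
  fix x y z :: octonion and s t :: real
  show "x + y + z = x + (y + z)" "x + y = y + x" "0 + x = x" "- x + x = 0" "x - y = x + - y"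
    by (simp_all add: plus_octonion_def zero_octonion_def uminus_octonion_def
        minus_octonion_def algebra_simps)
  show "s *\<^sub>R (x + y) = s *\<^sub>R x + s *\<^sub>R y" "(s + t) *\<^sub>R x = s *\<^sub>R x + t *\<^sub>R x"
    "s *\<^sub>R t *\<^sub>R x = (s * t) *\<^sub>R x" "1 *\<^sub>R x = x"
    by (simp_all add: plus_octonion_def scaleR_octonion_def algebra_simps)
  show "inner x y = inner y x" "inner (x + y) z = inner x z + inner y z"
    "inner (s *\<^sub>R x) y = s * inner x y" "0 \<le> inner x x"
    by (simp_all add: inner_octonion_def plus_octonion_def scaleR_octonion_def
        inner_commute inner_add_left algebra_simps)
  show "inner x x = 0 \<longleftrightarrow> x = 0"
    by (cases x) (simp add: inner_octonion_def zero_octonion_def add_nonneg_eq_0_iff)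
  show "(Basis :: octonion set) \<noteq> {}" "finite (Basis :: octonion set)"
    by (simp_all add: Basis_octonion_def)
  show "inner x y = (if x = y then 1 else 0)" if "x \<in> Basis" "y \<in> Basis"
    using that by (auto simp: Basis_octonion_def inner_octonion_def inner_Basis split: if_splits)
  show "(\<forall>y\<in>Basis. inner x y = 0) \<longleftrightarrow> x = 0"
    by (cases x) (simp add: Basis_octonion_def inner_octonion_def zero_octonion_def
        ball_Un euclidean_all_zero_iff)
qed (simp_all add: norm_octonion_def sgn_octonion_def dist_octonion_def
      uniformity_octonion_def open_octonion_def)

end

instantiation octonion :: times
begin
definition "x * y = Oct
  (oct_fst x * oct_fst y - quat_cnj (oct_snd y) * oct_snd x)
  (oct_snd y * oct_fst x + oct_snd x * quat_cnj (oct_fst y))"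
instance ..
end

definition oct_cnj :: "octonion \<Rightarrow> octonion" where
  "oct_cnj x = Oct (quat_cnj (oct_fst x)) (- oct_snd x)"

lemmas quaternion_defs =
  zero_quaternion_def plus_quaternion_def uminus_quaternion_def minus_quaternion_def
  scaleR_quaternion_def inner_quaternion_def times_quaternion_def quat_cnj_def

lemmas octonion_defs =
  zero_octonion_def plus_octonion_def uminus_octonion_def minus_octonion_def
  scaleR_octonion_def inner_octonion_def times_octonion_def oct_cnj_def

lemma hamilton_relations:
  defines "i \<equiv> Quat \<i> 0" and "j \<equiv> Quat 0 1" and "k \<equiv> Quat 0 \<i>"
  shows "i * j = k" "j * k = i" "k * i = j"
    "i * i = Quat (- 1) 0" "j * j = Quat (- 1) 0" "k * k = Quat (- 1) 0"
  by (simp_all add: assms times_quaternion_def)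

lemma norm_mult_octonion: "norm (x * y) = norm x * norm y" for x y :: octonion
proof -
  obtain a0 a1 a2 a3 a4 a5 a6 a7 where x:
    "x = Oct (Quat (Complex a0 a1) (Complex a2 a3)) (Quat (Complex a4 a5) (Complex a6 a7))"
    by (metis complex.exhaust quaternion.exhaust octonion.exhaust)
  obtain b0 b1 b2 b3 b4 b5 b6 b7 where y:
    "y = Oct (Quat (Complex b0 b1) (Complex b2 b3)) (Quat (Complex b4 b5) (Complex b6 b7))"
    by (metis complex.exhaust quaternion.exhaust octonion.exhaust)
  have "inner (x * y) (x * y) = inner x x * inner y y"
    unfolding x y
    by (simp add: octonion_defs quaternion_defs inner_complex_def) algebra
  then show ?thesis
    by (simp add: norm_octonion_def flip: real_sqrt_mult)
qed

section \<open>The four algebras\<close>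

(* The members of this class are, up to isometric isomorphism, exactly the real numbers, the
   complex numbers, the quaternions and the octonions: each embeds, compatibly with addition,
   scalars, norm, product and conjugation, as one term of the standard chain
   R < C < H < O.  So a type variable of this class ranges over K in {R, C, H, O}, and
   k = DIM('k) - 1. *)

class rcho = euclidean_space + times +
  fixes conjugate :: "'a \<Rightarrow> 'a"
    and to_oct :: "'a \<Rightarrow> octonion"
  assumes to_oct_add: "to_oct (x + y) = to_oct x + to_oct y"
    and to_oct_scaleR: "to_oct (scaleR r x) = scaleR r (to_oct x)"
    and norm_to_oct: "norm (to_oct x) = norm x"
    and to_oct_mult: "to_oct (x * y) = to_oct x * to_oct y"
    and to_oct_conjugate: "to_oct (conjugate x) = oct_cnj (to_oct x)"
    and range_to_oct: "range to_oct \<in>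
      {range (\<lambda>r. Oct (Quat (of_real r) 0) 0), range (\<lambda>c. Oct (Quat c 0) 0),
       range (\<lambda>p. Oct p 0), UNIV}"

instantiation real :: rcho
begin
definition "conjugate (x :: real) = x"
definition "to_oct (x :: real) = Oct (Quat (of_real x) 0) 0"
instance
  by standard (simp_all add: conjugate_real_def to_oct_real_def octonion_defs quaternion_defs
      norm_octonion_def inner_complex_def complex_eq_iff fun_eq_iff)
end

instantiation complex :: rcho
begin
definition "conjugate = cnj"
definition "to_oct c = Oct (Quat c 0) 0"
instance
  by standard (simp_all add: conjugate_complex_def to_oct_complex_def octonion_defs
      quaternion_defs norm_octonion_def norm_eq_sqrt_inner)
end

instantiation quaternion :: rcho
begin
definition "conjugate = quat_cnj"
definition "to_oct p = Oct p 0"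
instance
  by standard (simp_all add: conjugate_quaternion_def to_oct_quaternion_def octonion_defs
      quaternion_defs norm_octonion_def norm_eq_sqrt_inner)
end

instantiation octonion :: rcho
begin
definition "conjugate = oct_cnj"
definition "to_oct (x :: octonion) = x"
instance
  by standard (simp_all add: conjugate_octonion_def to_oct_octonion_def)
end

lemma DIM_quaternion: "DIM(quaternion) = 4" and DIM_octonion: "DIM(octonion) = 8"
proof -
  have "DIM(quaternion) = card ((\<lambda>b. Quat b 0) ` Basis) + card (Quat 0 ` Basis)"
    unfolding Basis_quaternion_def
    by (rule card_Un_disjoint) (auto dest: nonzero_Basis)
  also have "\<dots> = 4"
    by (simp add: card_image inj_on_def)
  finally show 4: "DIM(quaternion) = 4" .
  have "DIM(octonion) = card ((\<lambda>b. Oct b 0) ` Basis) + card (Oct 0 ` Basis)"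
    unfolding Basis_octonion_def
    by (rule card_Un_disjoint) (auto dest: nonzero_Basis)
  also have "\<dots> = 8"
    by (simp add: card_image inj_on_def 4)
  finally show "DIM(octonion) = 8" .
qed

section \<open>Right multiplication, the projective map and the Hopf map\<close>

definition vec_rmult :: "'k::rcho ^ 'n \<Rightarrow> 'k \<Rightarrow> 'k ^ 'n" where
  "vec_rmult \<omega> \<zeta> = (\<chi> i. \<omega> $ i * \<zeta>)"

definition pair_rmult :: "'k::rcho \<times> 'k \<Rightarrow> 'k \<Rightarrow> 'k \<times> 'k" where
  "pair_rmult \<omega> \<zeta> = (fst \<omega> * \<zeta>, snd \<omega> * \<zeta>)"

(* K^(n+1) is 'k ^ 'n with CARD('n) = n + 1; the coordinate omega_(n+1) is the one at the
   largest index. *)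

definition proj_map :: "'k::rcho ^ 'n::{finite,linorder} \<Rightarrow> ('k, 'n) vec set" where
  "proj_map \<omega> = (let l = \<omega> $ Max UNIV in
     if l \<noteq> 0 then {vec_rmult (vec_rmult \<omega> (conjugate l)) \<zeta> /\<^sub>R norm l | \<zeta>. \<zeta> \<in> sphere 0 1}
     else {vec_rmult \<omega> \<zeta> | \<zeta>. \<zeta> \<in> sphere 0 1})"

definition proj_space :: "('k::rcho ^ 'n::{finite,linorder}) set set" where
  "proj_space = proj_map ` sphere 0 1"

definition hopf_map :: "'k::rcho \<times> 'k \<Rightarrow> real \<times> 'k" where
  "hopf_map = (\<lambda>(a, b). ((norm a)\<^sup>2 - (norm b)\<^sup>2, 2 *\<^sub>R (a * conjugate b)))"

section \<open>Uniform measures\<close>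

(* Radial projection of the uniform distribution on the unit ball, a probability measure with
   space sphere 0 1.  For a one-dimensional type this is the fair coin on S^0 = {-1, 1}. *)

definition sphere_measure :: "'a::euclidean_space measure" where
  "sphere_measure = restrict_space
     (distr (uniform_measure lborel (ball 0 1)) borel (\<lambda>x. x /\<^sub>R norm x)) (sphere 0 1)"

lemma space_sphere_measure: "space sphere_measure = sphere 0 1"
  by (simp add: sphere_measure_def space_restrict_space)

lemma prob_space_sphere_measure: "prob_space (sphere_measure :: 'a::euclidean_space measure)"
proof -
  let ?U = "uniform_measure lborel (ball 0 1 :: 'a set)"
  let ?g = "\<lambda>x::'a. x /\<^sub>R norm x"
  have ball: "emeasure lborel (ball 0 1 :: 'a set) \<noteq> 0"
    "emeasure lborel (ball 0 1 :: 'a set) \<noteq> \<infinity>"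
    using content_ball_pos[of 1 "0 :: 'a"] emeasure_lborel_ball_finite[of "0 :: 'a" 1]
    by (auto simp: measure_def)
  have g: "?g \<in> measurable ?U borel"
    by measurable
  interpret U: prob_space ?U
    using ball by (intro prob_space_uniform_measure) auto
  interpret D: prob_space "distr ?U borel ?g"
    by (rule U.prob_space_distr[OF g])
  have "AE x in lborel. x \<noteq> (0::'a)"
    by (rule AE_lborel_singleton)
  then have "AE x in ?U. ?g x \<in> sphere 0 1"
    using ball by (intro AE_uniform_measureI) auto
  then have "emeasure (distr ?U borel ?g) (sphere 0 1) = 1"
    using g by (intro D.emeasure_eq_1_AE) (auto simp: AE_distr_iff)
  then show ?thesis
    unfolding sphere_measure_def by (intro prob_space_restrict_space) auto
qed

(* Push-forward along the projective map, with the quotient sigma-algebra. *)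

definition proj_measure :: "('k::rcho ^ 'n::{finite,linorder}) set measure" where
  "proj_measure = distr sphere_measure
     (sigma proj_space {A. A \<subseteq> proj_space \<and> proj_map -` A \<inter> sphere 0 1 \<in> sets sphere_measure})
     proj_map"

section \<open>Polynomials and designs\<close>

definition polys :: "nat \<Rightarrow> ('a::euclidean_space \<Rightarrow> real) set" where
  "polys t = {p. \<exists>c. \<forall>x. p x =
     (\<Sum>\<alpha> | \<alpha> \<in> Basis \<rightarrow>\<^sub>E UNIV \<and> sum \<alpha> Basis \<le> t. c \<alpha> * (\<Prod>b\<in>Basis. (x \<bullet> b) ^ \<alpha> b))}"

(* Functions on a sphere or on projective space are total functions of which only the values
   there matter. *)

definition sphere_polys :: "nat \<Rightarrow> ('a::euclidean_space \<Rightarrow> real) set" where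
  "sphere_polys t = {f. \<exists>p\<in>polys t. \<forall>x\<in>sphere 0 1. f x = p x}"

definition proj_polys :: "nat \<Rightarrow> (('k::rcho ^ 'n::{finite,linorder}) set \<Rightarrow> real) set" where
  "proj_polys t = {f. f \<circ> proj_map \<in> sphere_polys (2 * t)}"

definition weighted_design ::
    "'a measure \<Rightarrow> (nat \<Rightarrow> ('a \<Rightarrow> real) set) \<Rightarrow> nat \<Rightarrow> 'a set \<Rightarrow> ('a \<Rightarrow> real) \<Rightarrow> bool" where
  "weighted_design \<mu> P t X w \<longleftrightarrow> finite X \<and> X \<subseteq> space \<mu> \<and> (\<forall>x\<in>X. w x > 0) \<and>
     (\<forall>f\<in>P t. (\<Sum>x\<in>X. w x * f x) = integral\<^sup>L \<mu> f)"

definition unweighted_design ::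
    "'a measure \<Rightarrow> (nat \<Rightarrow> ('a \<Rightarrow> real) set) \<Rightarrow> nat \<Rightarrow> 'a set \<Rightarrow> bool" where
  "unweighted_design \<mu> P t X \<longleftrightarrow> weighted_design \<mu> P t X (\<lambda>_. 1 / real (card X))"

abbreviation "sphere_design \<equiv> weighted_design sphere_measure sphere_polys"
abbreviation "proj_design \<equiv> weighted_design proj_measure proj_polys"
abbreviation "unweighted_sphere_design \<equiv> unweighted_design sphere_measure sphere_polys"
abbreviation "unweighted_proj_design \<equiv> unweighted_design proj_measure proj_polys"

end

(* Powers of linear forms span the polynomials, so a design of degree t is characterised by the
   moments of (x . u)^j for j <= t, and on the unit sphere these are c_j |u|^j by rotation invariance.
   The average of (x . u)^(2m) over the fibre through a base point z is c_(2m) |z* u|^(2m), where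
   z* is the adjoint of right multiplication zeta |-> z zeta.  In the associative case z* u is the
   sum of the conj(z_i) u_i, hence |z* u|^2 descends.  Over the octonions, and for the Hopf map h,
   |z* u|^2 = (|z|^2 |u|^2 + <h z, h u>) / 2 instead, where the base point condition supplies the
   missing associativity.  The map h pushes the uniform measure forward to the uniform measure
   because x |-> <h x, u> is the quadratic form of an operator A_u with A_u^2 = |u|^2, and
   A_(u+e) intertwines A_u with A_e. *)

theory Submission
  imports Defs
begin

section \<open>Octonions and the class rcho\<close>

text \<open>Over the octonions right multiplication by units is not a group action, so translates of
  a point can leave its fibre and |z* u|^2 need not be a function of the fibre. Two devices deal
  with this. The formula for |z* u|^2 rests on a single instance of associativity, (a conj(b)) d = a
  (conj(b) d) for z = (a, b) and u = (c, d), and this instance follows from invariance of the Hopf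
  map under all unit translates of z. The global identity, which equates c_(2m) times the integral
  of the m-th power of the descended function with the moment of (x . u)^(2m), cannot be had by
  integrating that formula, since a general x is no admissible base point. It is verified for one
  vector v with |v| = |u| for which the formula holds at every x, and a reflection of the target
  sphere carries it over to u. The bound floor(t/2) has a simple origin: odd powers integrate to
  zero on both spheres, while (x . u)^(2m) averages to a multiple of the m-th power of a function of
  degree 1 on the base.\<close>

lemma oct_add_mult: "((x::octonion) + y) * z = x * z + y * z"
  and oct_mult_add: "z * (x + y) = z * x + z * y"
  and oct_scaleR_mult: "(r *\<^sub>R x) * z = r *\<^sub>R (x * z)"
  and oct_mult_scaleR: "z * (r *\<^sub>R x) = r *\<^sub>R (z * x)"
  and oct_cnj_add: "oct_cnj (x + y) = oct_cnj x + oct_cnj y"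
  and oct_cnj_scaleR: "oct_cnj (r *\<^sub>R x) = r *\<^sub>R oct_cnj x"
  and oct_cnj_cnj: "oct_cnj (oct_cnj x) = x"
  by (simp_all add: octonion_defs quaternion_defs algebra_simps scaleR_conv_of_real)

lemma quat_mult_assoc: "((p::quaternion) * q) * r = p * (q * r)"
  and inner_quat_mult_left: "inner (p * q) r = inner p (r * quat_cnj q)"
  and inner_quat_mult_right: "inner (p * q) r = inner q (quat_cnj p * r)"
  and quat_cnj_mult: "quat_cnj (p * q) = quat_cnj q * quat_cnj p"
  and quat_mult_cnj: "p * quat_cnj p = Quat (of_real (inner p p)) 0"
  and quat_cnj_mult_self: "quat_cnj p * p = Quat (of_real (inner p p)) 0"
  by (cases p; cases q; cases r;
      simp add: quaternion_defs inner_complex_def complex_eq_iff algebra_simps)+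

lemma quat_arith:
  "((p::quaternion) + q) * r = p * r + q * r" "r * (p + q) = r * p + r * q"
  "(p - q) * r = p * r - q * r" "r * (p - q) = r * p - r * q"
  "- p * r = - (p * r)" "r * - p = - (r * p)"
  "(x *\<^sub>R p) * r = x *\<^sub>R (p * r)" "r * (x *\<^sub>R p) = x *\<^sub>R (r * p)"
  "quat_cnj (p + q) = quat_cnj p + quat_cnj q" "quat_cnj (p - q) = quat_cnj p - quat_cnj q"
  "quat_cnj (- p) = - quat_cnj p" "quat_cnj (x *\<^sub>R p) = x *\<^sub>R quat_cnj p"
  "quat_cnj (quat_cnj p) = p"
  by (simp_all add: quaternion_defs algebra_simps scaleR_conv_of_real)

text \<open>After doubling, every term is an inner product involving a product of just two
  quaternions, so the quaternion rules move one factor across without any associativity of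
  octonions.\<close>

lemma inner_oct_mult_left: "inner ((x::octonion) * y) z = inner x (z * oct_cnj y)"
  and inner_oct_mult_right: "inner (x * y) z = inner y (oct_cnj x * z)"
proof -
  \<comment> \<open>The instances select which factor moves in each term.\<close>
  note flips = inner_quat_mult_left[of "oct_fst x" "oct_fst y"] inner_quat_mult_left[of "oct_snd x"]
    inner_quat_mult_right[of "quat_cnj (oct_snd y)"] inner_quat_mult_right[of "oct_snd y"]
  show "inner (x * y) z = inner x (z * oct_cnj y)"
    by (simp add: octonion_defs quat_arith inner_add_right inner_diff_left inner_diff_right flips inner_add_left)
  have "inner (quat_cnj (oct_snd y) * oct_snd x) (oct_fst z) = inner (oct_snd y) (oct_snd x * quat_cnj (oct_fst z))"
    by (metis inner_commute inner_quat_mult_left inner_quat_mult_right quat_arith(13))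
  moreover have "inner (oct_snd x * quat_cnj (oct_fst y)) (oct_snd z) = inner (oct_fst y) (quat_cnj (oct_snd z) * oct_snd x)"
    by (metis inner_commute inner_quat_mult_left inner_quat_mult_right quat_arith(13))
  ultimately show "inner (x * y) z = inner y (oct_cnj x * z)"
    by (simp add: octonion_defs quat_arith inner_add_right inner_diff_left inner_diff_right inner_add_left
      inner_quat_mult_right[of "oct_fst x"] inner_quat_mult_left[of "oct_snd y"])
qed

lemma oct_cnj_mult: "oct_cnj (x * y) = oct_cnj y * oct_cnj x"
  by (simp add: octonion_defs quat_arith quat_cnj_mult)

lemma oct_mult_cnj_mult: "(x * oct_cnj x) * y = (norm x)\<^sup>2 *\<^sub>R y"
proof -
  have "x * oct_cnj x = Oct (Quat (of_real ((norm x)\<^sup>2)) 0) 0"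
    by (simp add: power2_norm_eq_inner octonion_defs quat_arith quat_mult_cnj quat_cnj_mult_self)
      (simp add: quaternion_defs)
  then show ?thesis
    by (simp add: octonion_defs quaternion_defs scaleR_conv_of_real)
qed

section \<open>Transport of octonion identities to the four algebras\<close>

lemma linear_to_oct: "linear (to_oct :: 'a::rcho \<Rightarrow> octonion)"
  by (intro linearI) (simp_all add: to_oct_add to_oct_scaleR)

lemma inj_to_oct: "inj (to_oct :: 'a::rcho \<Rightarrow> octonion)"
  using linear_injective_0[OF linear_to_oct] by (metis norm_eq_zero norm_to_oct)

lemma inner_to_oct: "inner (to_oct x) (to_oct y) = inner x y"
  by (simp add: dot_norm norm_to_oct flip: to_oct_add)

lemma rcho_add_mult: "(x + y) * z = x * z + y * z"
  and rcho_mult_add: "z * (x + y) = z * x + z * y"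
  and rcho_scaleR_mult: "(r *\<^sub>R x) * z = r *\<^sub>R (x * z)"
  and rcho_mult_scaleR: "z * (r *\<^sub>R x) = r *\<^sub>R (z * x)"
  and conjugate_add: "conjugate (x + y) = conjugate x + conjugate y"
  and conjugate_scaleR: "conjugate (r *\<^sub>R x) = r *\<^sub>R conjugate x"
  and conjugate_conjugate [simp]: "conjugate (conjugate x) = x"
  and conjugate_mult: "conjugate (x * y) = conjugate y * conjugate x"
  and mult_conjugate_mult: "(x * conjugate x) * y = (norm x)\<^sup>2 *\<^sub>R y" for x y z :: "'a::rcho"
  by (rule injD[OF inj_to_oct]; simp add: to_oct_add to_oct_scaleR to_oct_mult to_oct_conjugate
    oct_add_mult oct_mult_add oct_scaleR_mult oct_mult_scaleR oct_cnj_add oct_cnj_scaleR oct_cnj_cnj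
    oct_mult_cnj_mult oct_cnj_mult norm_to_oct)+

lemma norm_mult_rcho: "norm (x * y) = norm x * norm y" for x y :: "'a::rcho"
  by (metis norm_mult_octonion norm_to_oct to_oct_mult)

lemma inner_mult_left_rcho: "inner (x * y) z = inner x (z * conjugate y)"
  and inner_mult_right_rcho: "inner (x * y) z = inner y (conjugate x * z)" for x y z :: "'a::rcho"
  by (metis inner_to_oct to_oct_mult to_oct_conjugate inner_oct_mult_left)
    (metis inner_to_oct to_oct_mult to_oct_conjugate inner_oct_mult_right)

lemma inner_conjugate: "inner (conjugate x) (conjugate y) = inner x y" for x y :: "'a::rcho"
proof -
  have "inner (oct_cnj u) (oct_cnj v) = inner u v" for u v
    by (simp add: octonion_defs quaternion_defs inner_complex_def)
  then show ?thesis
    by (metis inner_to_oct to_oct_conjugate)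
qed

lemma norm_conjugate [simp]: "norm (conjugate x) = norm x" for x :: "'a::rcho"
  by (simp add: norm_eq_sqrt_inner inner_conjugate)

lemma bounded_bilinear_mult_rcho: "bounded_bilinear ((*) :: 'a::rcho \<Rightarrow> 'a \<Rightarrow> 'a)"
  by standard (auto simp: rcho_add_mult rcho_mult_add rcho_scaleR_mult rcho_mult_scaleR norm_mult_rcho
      intro!: exI[of _ 1])

lemma linear_conjugate: "linear (conjugate :: 'a::rcho \<Rightarrow> 'a)"
  by (intro linearI) (simp_all add: conjugate_add conjugate_scaleR)

text \<open>This is the multiplicative norm in polarized form.\<close>

lemma inner_mult_mult: "inner (x * z) (y * z) = (norm z)\<^sup>2 * inner x y"
  "inner (z * x) (z * y) = (norm z)\<^sup>2 * inner x y" for x y z :: "'a::rcho"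
  by (simp_all add: dot_norm norm_mult_rcho power_mult_distrib right_diff_distrib
    flip: rcho_add_mult rcho_mult_add)

text \<open>These cancellation laws stand in for associativity over the octonions. By adjointness
  \<open>inner ((x * z) * conjugate z) v\<close> equals \<open>inner (x * z) (v * z)\<close>, which
  \<open>inner_mult_mult\<close> evaluates.\<close>

lemma mult_conjugate_cancel: "(x * z) * conjugate z = (norm z)\<^sup>2 *\<^sub>R x"
  "conjugate z * (z * x) = (norm z)\<^sup>2 *\<^sub>R x"
  "(x * conjugate z) * z = (norm z)\<^sup>2 *\<^sub>R x"
  "z * (conjugate z * x) = (norm z)\<^sup>2 *\<^sub>R x" for x z :: "'a::rcho"
proof -
  have *: "(x * z) * conjugate z = (norm z)\<^sup>2 *\<^sub>R x" "conjugate z * (z * x) = (norm z)\<^sup>2 *\<^sub>R x" for z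
  proof -
    have "inner ((x * z) * conjugate z) v = inner ((norm z)\<^sup>2 *\<^sub>R x) v" for v
      by (subst inner_mult_left_rcho) (simp add: inner_mult_mult)
    then show "(x * z) * conjugate z = (norm z)\<^sup>2 *\<^sub>R x"
      using vector_eq_rdot by blast
    have "inner (conjugate z * (z * x)) v = inner ((norm z)\<^sup>2 *\<^sub>R x) v" for v
      by (subst inner_mult_right_rcho) (simp add: inner_mult_mult)
    then show "conjugate z * (z * x) = (norm z)\<^sup>2 *\<^sub>R x"
      using vector_eq_rdot by blast
  qed
  show "(x * z) * conjugate z = (norm z)\<^sup>2 *\<^sub>R x" "conjugate z * (z * x) = (norm z)\<^sup>2 *\<^sub>R x"
    "(x * conjugate z) * z = (norm z)\<^sup>2 *\<^sub>R x" "z * (conjugate z * x) = (norm z)\<^sup>2 *\<^sub>R x"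
    using *[of z] *[of "conjugate z"] by simp_all
qed

text \<open>A surjective \<open>to_oct\<close> would force dimension 8; every other range that the
  class admits lies in the quaternions.\<close>

lemma mult_assoc_rcho: "(x * y) * z = x * (y * z)" if "DIM('a) \<noteq> 8" for x y z :: "'a::rcho"
proof -
  have "range (to_oct :: 'a \<Rightarrow> _) \<noteq> UNIV"
  proof
    assume "range (to_oct :: 'a \<Rightarrow> _) = UNIV"
    then have "DIM('a) = DIM(octonion)"
      using inj_to_oct linear_to_oct by (metis dim_UNIV dim_image_eq inj_on_subset top_greatest)
    with that show False
      by (simp add: DIM_octonion)
  qed
  with range_to_oct[where 'a='a] have "range (to_oct :: 'a \<Rightarrow> _) \<subseteq> range (\<lambda>p. Oct p 0)"
    by (elim insertE) auto
  then have "\<exists>p. to_oct v = Oct p 0" for v :: 'a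
    by blast
  then obtain p q r where "to_oct x = Oct p 0" "to_oct y = Oct q 0" "to_oct z = Oct r 0"
    by metis
  then show ?thesis
    by - (rule injD[OF inj_to_oct],
       simp add: to_oct_mult times_octonion_def quat_mult_assoc quat_arith,
       simp add: quaternion_defs)
qed

lemma rcho_mult_zero [simp]: "0 * x = 0" "x * 0 = 0" "conjugate 0 = 0" for x :: "'a::rcho"
  by (simp_all add: bounded_bilinear.zero_left[OF bounded_bilinear_mult_rcho]
      bounded_bilinear.zero_right[OF bounded_bilinear_mult_rcho] linear_0[OF linear_conjugate])

text \<open>The class carries no constant 1. For a unit vector c the product
  \<open>c * conjugate c\<close> is a left unit, and conjugation, which fixes it and reverses
  products, makes it a right unit.\<close>

lemma rcho_right_one: "\<exists>e :: 'k::rcho. norm e = 1 \<and> (\<forall>x. x * e = x)"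
proof -
  obtain c :: 'k where c: "norm c = 1"
    by (metis norm_Basis nonempty_Basis ex_in_conv)
  have e: "(c * conjugate c) * x = x" for x
    by (simp add: mult_conjugate_mult c)
  have "x * (c * conjugate c) = x" for x
    using arg_cong[OF e[of "conjugate x"], of conjugate] by (simp add: conjugate_mult)
  then show ?thesis
    using c by (intro exI[of _ "c * conjugate c"]) (simp add: norm_mult_rcho)
qed

section \<open>Polynomials and powers of linear forms\<close>

text \<open>The parameter is a set of exponents so that one notion covers the homogeneous case
  \<open>{j}\<close>, in which polarization takes place, and the span \<open>{..t}\<close> of all
  degrees up to t.\<close>

inductive_set lin_pows :: "nat set \<Rightarrow> ('a::euclidean_space \<Rightarrow> real) set" for J where
  pow: "j \<in> J \<Longrightarrow> (\<lambda>x. (x \<bullet> u) ^ j) \<in> lin_pows J"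
| add: "f \<in> lin_pows J \<Longrightarrow> g \<in> lin_pows J \<Longrightarrow> (\<lambda>x. f x + g x) \<in> lin_pows J"
| scale: "f \<in> lin_pows J \<Longrightarrow> (\<lambda>x. c * f x) \<in> lin_pows J"

lemma lin_pows_mono: "f \<in> lin_pows I \<Longrightarrow> I \<subseteq> J \<Longrightarrow> f \<in> lin_pows J"
  by (induction rule: lin_pows.induct) (auto intro: lin_pows.intros)

lemma lin_pows_zero: "j \<in> J \<Longrightarrow> (\<lambda>x. 0) \<in> lin_pows J"
  using lin_pows.scale[OF lin_pows.pow, of j J 0] by simp

lemma lin_pows_sum:
  assumes "j \<in> J" "\<And>i. i \<in> I \<Longrightarrow> f i \<in> lin_pows J"
  shows "(\<lambda>x. \<Sum>i\<in>I. f i x) \<in> lin_pows J"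
  using assms(2) by (induction I rule: infinite_finite_induct)
    (auto intro: lin_pows_zero[OF assms(1)] lin_pows.add)

text \<open>For a polynomial \<^term>\<open>p\<close> of degree \<^term>\<open>n\<close>, the term of degree \<^term>\<open>n\<close> cancels in
  \<^term>\<open>p (2 * s) - 2 ^ n * p s\<close>; this replaces the inversion of a Vandermonde matrix.\<close>

lemma lin_pows_coeff:
  assumes "j \<in> J" "\<And>s::real. (\<lambda>x. \<Sum>i\<le>n. s ^ i * F i x) \<in> lin_pows J" "i \<le> n"
  shows "F i \<in> lin_pows J"
  using assms(2,3)
proof (induction n arbitrary: F i)
  case 0
  then show ?case
    using 0(1)[of 1] by simp
next
  case (Suc n)
  define G where "G i x = (2 ^ i - 2 ^ Suc n) * F i x" for i x
  have "(\<lambda>x. \<Sum>i\<le>n. s ^ i * G i x) \<in> lin_pows J" for s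
  proof -
    have "(\<lambda>x. (\<Sum>i\<le>Suc n. (2 * s) ^ i * F i x) + (- (2 ^ Suc n)) * (\<Sum>i\<le>Suc n. s ^ i * F i x))
      \<in> lin_pows J"
      by (intro lin_pows.add lin_pows.scale Suc.prems)
    also have "(\<lambda>x. (\<Sum>i\<le>Suc n. (2 * s) ^ i * F i x) + (- (2 ^ Suc n)) * (\<Sum>i\<le>Suc n. s ^ i * F i x))
      = (\<lambda>x. \<Sum>i\<le>n. s ^ i * G i x)"
      by (simp add: G_def fun_eq_iff sum_distrib_left algebra_simps sum_subtractf sum_negf
          del: power_Suc)
    finally show ?thesis .
  qed
  then have G: "G i \<in> lin_pows J" if "i \<le> n" for i
    using Suc.IH that by blast
  have F: "F i \<in> lin_pows J" if "i \<le> n" for i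
  proof -
    have "F i = (\<lambda>x. inverse (2 ^ i - 2 ^ Suc n) * G i x)"
      using that power_strict_increasing[of i "Suc n" "2::real"] by (auto simp: G_def fun_eq_iff)
    with lin_pows.scale[OF G[OF that]] show ?thesis
      by metis
  qed
  have "(\<lambda>x. (\<Sum>i\<le>Suc n. 1 ^ i * F i x) + (-1) * (\<Sum>i\<le>n. F i x)) \<in> lin_pows J"
    using F by (intro lin_pows.add lin_pows.scale Suc.prems lin_pows_sum[OF assms(1)]) auto
  then have "F (Suc n) \<in> lin_pows J"
    by simp
  with F Suc.prems show ?case
    by (metis le_Suc_eq)
qed

text \<open>Polarization: in the expansion of (x . (s v + u))^(j+1) in powers of s, the coefficient
  of s is (j+1) (x . v) (x . u)^j, and \<open>lin_pows_coeff\<close> extracts it.\<close>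

lemma lin_pows_mult_inner:
  assumes "f \<in> lin_pows {j}"
  shows "(\<lambda>x. (x \<bullet> v) * f x) \<in> lin_pows {Suc j}"
  using assms
proof induction
  case (pow i u)
  define F where "F i x = real (Suc j choose i) * (x \<bullet> v) ^ i * (x \<bullet> u) ^ (Suc j - i)" for i x
  have "(\<lambda>x. \<Sum>i\<le>Suc j. s ^ i * F i x) \<in> lin_pows {Suc j}" for s
  proof -
    have "(\<lambda>x. (x \<bullet> (s *\<^sub>R v + u)) ^ Suc j) \<in> lin_pows {Suc j}"
      by (rule lin_pows.pow) simp
    also have "(\<lambda>x. (x \<bullet> (s *\<^sub>R v + u)) ^ Suc j) = (\<lambda>x. \<Sum>i\<le>Suc j. s ^ i * F i x)"
    proof
      fix x
      have *: "C * (s * a) ^ i * b ^ k = s ^ i * (C * a ^ i * b ^ k)" for C a b :: real and i k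
        by (simp add: power_mult_distrib)
      have "(x \<bullet> (s *\<^sub>R v + u)) ^ Suc j = (s * (x \<bullet> v) + x \<bullet> u) ^ Suc j"
        by (simp only: inner_add_right inner_scaleR_right)
      also have "\<dots> = (\<Sum>i\<le>Suc j. s ^ i * F i x)"
        unfolding F_def by (subst binomial_ring, intro sum.cong refl, rule *)
      finally show "(x \<bullet> (s *\<^sub>R v + u)) ^ Suc j = (\<Sum>i\<le>Suc j. s ^ i * F i x)" .
    qed
    finally show ?thesis .
  qed
  then have "F 1 \<in> lin_pows {Suc j}"
    by (rule lin_pows_coeff[where n="Suc j", rotated]) auto
  then have "(\<lambda>x. inverse (real (Suc j)) * F 1 x) \<in> lin_pows {Suc j}"
    by (rule lin_pows.scale)
  also have "(\<lambda>x. inverse (real (Suc j)) * F 1 x) = (\<lambda>x. (x \<bullet> v) * (x \<bullet> u) ^ i)"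
    using pow unfolding F_def by (intro ext) (simp add: field_simps del: of_nat_Suc)
  finally show ?case .
next
  case (add f g)
  from lin_pows.add[OF add.IH] show ?case
    by (simp add: distrib_left)
next
  case (scale f c)
  from lin_pows.scale[OF scale.IH, of c] show ?case
    by (simp add: mult_ac)
qed

lemma lin_pows_monomial:
  assumes "finite B"
  shows "(\<lambda>x. \<Prod>b\<in>B. (x \<bullet> b) ^ \<alpha> b) \<in> lin_pows {sum \<alpha> B}"
  using assms
proof induction
  case empty
  show ?case
    using lin_pows.pow[of 0 "{0}" 0] by simp
next
  case (insert b B)
  have "(\<lambda>x. (x \<bullet> b) ^ k * (\<Prod>b\<in>B. (x \<bullet> b) ^ \<alpha> b)) \<in> lin_pows {k + sum \<alpha> B}" for k
  proof (induction k)
    case (Suc k)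
    from lin_pows_mult_inner[OF this, of b] show ?case
      by (simp add: mult_ac)
  qed (use insert.IH in simp)
  with insert.hyps show ?case
    by simp
qed

section \<open>Polynomials of bounded degree and their closure properties\<close>

definition multidegs :: "nat \<Rightarrow> ('a::euclidean_space \<Rightarrow> nat) set" where
  "multidegs t = {\<alpha>. \<alpha> \<in> Basis \<rightarrow>\<^sub>E UNIV \<and> sum \<alpha> Basis \<le> t}"

definition monomial :: "('a::euclidean_space \<Rightarrow> nat) \<Rightarrow> 'a \<Rightarrow> real" where
  "monomial \<alpha> x = (\<Prod>b\<in>Basis. (x \<bullet> b) ^ \<alpha> b)"

lemma polys_iff: "p \<in> polys t \<longleftrightarrow> (\<exists>c. p = (\<lambda>x. \<Sum>\<alpha>\<in>multidegs t. c \<alpha> * monomial \<alpha> x))"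
  by (auto simp: polys_def multidegs_def monomial_def fun_eq_iff)

lemma finite_multidegs: "finite (multidegs t :: ('a::euclidean_space \<Rightarrow> nat) set)"
proof (rule finite_subset)
  show "(multidegs t :: ('a \<Rightarrow> nat) set) \<subseteq> Basis \<rightarrow>\<^sub>E {..t}"
  proof
    fix \<alpha> :: "'a \<Rightarrow> nat"
    assume \<alpha>: "\<alpha> \<in> multidegs t"
    then have "\<alpha> b \<le> t" if "b \<in> Basis" for b
      using member_le_sum[of b Basis \<alpha>] that by (auto simp: multidegs_def)
    with \<alpha> show "\<alpha> \<in> Basis \<rightarrow>\<^sub>E {..t}"
      by (auto simp: multidegs_def PiE_iff)
  qed
  show "finite ((Basis :: 'a set) \<rightarrow>\<^sub>E {..t})"
    by (simp add: finite_PiE)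
qed

lemma polys_add: "p \<in> polys t \<Longrightarrow> q \<in> polys t \<Longrightarrow> (\<lambda>x. p x + q x) \<in> polys t"
proof -
  assume "p \<in> polys t" "q \<in> polys t"
  then obtain c d where "p = (\<lambda>x. \<Sum>\<alpha>\<in>multidegs t. c \<alpha> * monomial \<alpha> x)"
    "q = (\<lambda>x. \<Sum>\<alpha>\<in>multidegs t. d \<alpha> * monomial \<alpha> x)"
    unfolding polys_iff by blast
  then show ?thesis
    unfolding polys_iff
    by (intro exI[of _ "\<lambda>\<alpha>. c \<alpha> + d \<alpha>"]) (simp add: distrib_right sum.distrib)
qed

lemma polys_scale: "p \<in> polys t \<Longrightarrow> (\<lambda>x. c * p x) \<in> polys t"
proof -
  assume "p \<in> polys t"
  then obtain d where "p = (\<lambda>x. \<Sum>\<alpha>\<in>multidegs t. d \<alpha> * monomial \<alpha> x)"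
    unfolding polys_iff by blast
  then show ?thesis
    unfolding polys_iff
    by (intro exI[of _ "\<lambda>\<alpha>. c * d \<alpha>"]) (simp add: sum_distrib_left mult.assoc)
qed

lemma polys_zero: "(\<lambda>x. 0) \<in> polys t"
  unfolding polys_iff by (rule exI[of _ "\<lambda>_. 0"]) simp

lemma polys_sum: "(\<And>i. i \<in> I \<Longrightarrow> f i \<in> polys t) \<Longrightarrow> (\<lambda>x. \<Sum>i\<in>I. f i x) \<in> polys t"
  by (induction I rule: infinite_finite_induct) (auto intro: polys_zero polys_add)

lemma polys_monomial:
  assumes "\<alpha> \<in> multidegs t"
  shows "monomial \<alpha> \<in> polys t"
  unfolding polys_iff using assms
  by (intro exI[of _ "\<lambda>\<beta>. if \<beta> = \<alpha> then 1 else 0"] ext)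
    (simp add: if_distrib[of "\<lambda>u. u * _"] finite_multidegs cong: if_cong)

lemma polys_mono:
  assumes "p \<in> polys s" "s \<le> t"
  shows "p \<in> polys t"
proof -
  have "multidegs s \<subseteq> multidegs t"
    using assms(2) by (auto simp: multidegs_def)
  with assms(1) show ?thesis
    unfolding polys_iff[of p s] by (auto intro!: polys_sum polys_scale polys_monomial)
qed

lemma polys_const: "(\<lambda>x. c) \<in> polys t"
proof -
  have "monomial (restrict (\<lambda>_. 0) Basis) \<in> polys t"
    by (rule polys_monomial) (auto simp: multidegs_def)
  also have "monomial (restrict (\<lambda>_. 0) Basis) = (\<lambda>_. 1)"
    by (simp add: monomial_def fun_eq_iff)
  finally show ?thesis
    using polys_scale[of "\<lambda>_. 1" t c] by simp
qed

lemma polys_mult_Basis: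
  assumes p: "p \<in> polys t" and b: "b \<in> Basis"
  shows "(\<lambda>x. (x \<bullet> b) * p x) \<in> polys (Suc t)"
proof -
  have *: "(\<lambda>x. (x \<bullet> b) * monomial \<alpha> x) \<in> polys (Suc t)" if \<alpha>: "\<alpha> \<in> multidegs t" for \<alpha>
  proof -
    have "monomial (\<alpha>(b := Suc (\<alpha> b))) \<in> polys (Suc t)"
      using \<alpha> b by (intro polys_monomial)
        (auto simp: multidegs_def PiE_iff extensional_def sum.remove[OF finite_Basis b])
    also have "monomial (\<alpha>(b := Suc (\<alpha> b))) = (\<lambda>x. (x \<bullet> b) * monomial \<alpha> x)"
      using b by (auto simp: fun_eq_iff monomial_def prod.remove[OF finite_Basis b] intro!: prod.cong)
    finally show ?thesis .
  qed
  from p obtain c where p: "p = (\<lambda>x. \<Sum>\<alpha>\<in>multidegs t. c \<alpha> * monomial \<alpha> x)"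
    unfolding polys_iff by blast
  have "(\<lambda>x. \<Sum>\<alpha>\<in>multidegs t. c \<alpha> * ((x \<bullet> b) * monomial \<alpha> x)) \<in> polys (Suc t)"
    by (intro polys_sum polys_scale *)
  then show ?thesis
    by (simp add: p sum_distrib_left mult_ac)
qed

lemma polys_mult_inner:
  assumes p: "p \<in> polys t"
  shows "(\<lambda>x. (x \<bullet> u) * p x) \<in> polys (Suc t)"
proof -
  have "(\<lambda>x. \<Sum>b\<in>Basis. (u \<bullet> b) * ((x \<bullet> b) * p x)) \<in> polys (Suc t)"
    by (intro polys_sum polys_scale polys_mult_Basis p)
  then show ?thesis
    by (subst euclidean_inner) (simp add: sum_distrib_left sum_distrib_right mult_ac)
qed

text \<open>A monomial is a product of linear forms, so repeated polarization turns it into powers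
  of linear forms with the same total exponent.\<close>

lemma polys_eq_lin_pows: "polys t = lin_pows {..t}"
proof (intro equalityI subsetI)
  fix p :: "'a \<Rightarrow> real"
  assume "p \<in> polys t"
  then obtain c where p: "p = (\<lambda>x. \<Sum>\<alpha>\<in>multidegs t. c \<alpha> * monomial \<alpha> x)"
    unfolding polys_iff by blast
  have "monomial \<alpha> \<in> lin_pows {..t}" if "\<alpha> \<in> multidegs t" for \<alpha> :: "'a \<Rightarrow> nat"
    using lin_pows_mono[OF lin_pows_monomial[OF finite_Basis, of \<alpha>]] that
    by (auto simp: multidegs_def monomial_def[abs_def])
  then show "p \<in> lin_pows {..t}"
    unfolding p by (intro lin_pows_sum[of 0] lin_pows.scale) auto
next
  fix p :: "'a \<Rightarrow> real"
  have pow: "(\<lambda>x. (x \<bullet> u) ^ j) \<in> polys j" for j and u :: 'a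
    by (induction j) (auto intro: polys_const polys_mult_inner)
  assume "p \<in> lin_pows {..t}"
  then show "p \<in> polys t"
    by induction (auto intro: polys_add polys_scale polys_mono[OF pow])
qed

text \<open>Statements that are linear in the polynomial are reduced to powers of linear forms. The
  sum case keeps membership in \<open>polys t\<close>, because additivity of integrals needs the
  continuity, hence integrability, of both summands.\<close>

lemma polys_induct [consumes 1, case_names pow add scale]:
  assumes "p \<in> polys t" "\<And>j u. j \<le> t \<Longrightarrow> Q (\<lambda>x. (x \<bullet> u) ^ j)"
    "\<And>f g. f \<in> polys t \<Longrightarrow> Q f \<Longrightarrow> g \<in> polys t \<Longrightarrow> Q g \<Longrightarrow> Q (\<lambda>x. f x + g x)"
    "\<And>f c. f \<in> polys t \<Longrightarrow> Q f \<Longrightarrow> Q (\<lambda>x. c * f x)"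
  shows "Q p"
proof -
  have "p \<in> lin_pows {..t}"
    using assms(1) by (simp add: polys_eq_lin_pows)
  then show ?thesis
  proof induction
    case (pow j u)
    then show ?case
      by (intro assms(2)) simp
  qed (use assms(3,4) in \<open>simp_all only: polys_eq_lin_pows\<close>)
qed

lemma polys_inner_power: "j \<le> t \<Longrightarrow> (\<lambda>x. (x \<bullet> u) ^ j) \<in> polys t"
  by (simp add: polys_eq_lin_pows lin_pows.pow)

lemma polys_mult:
  assumes "p \<in> polys s" "q \<in> polys t"
  shows "(\<lambda>x. p x * q x) \<in> polys (s + t)"
  using assms(2)
proof (induction rule: polys_induct)
  case (pow j u)
  have "(\<lambda>x. p x * (x \<bullet> u) ^ j) \<in> polys (s + j)"
  proof (induction j)
    case (Suc j)
    from polys_mult_inner[OF this, of u] show ?case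
      by (simp add: mult.left_commute)
  qed (use assms(1) in simp)
  with pow show ?case
    by (auto intro: polys_mono)
next
  case (add f g)
  then show ?case
    using polys_add[of "\<lambda>x. p x * f x" _ "\<lambda>x. p x * g x"] by (simp add: distrib_left)
next
  case (scale f c)
  then show ?case
    using polys_scale[of "\<lambda>x. p x * f x" _ c] by (simp add: mult_ac)
qed

lemma polys_power: "p \<in> polys s \<Longrightarrow> (\<lambda>x. p x ^ m) \<in> polys (s * m)"
  by (induction m) (auto intro: polys_const polys_mult)

text \<open>Moving L to its adjoint makes each term of the basis expansion a product of two linear
  forms.\<close>

lemma polys_quadratic_form:
  fixes L :: "'a::euclidean_space \<Rightarrow> 'a"
  assumes "linear L"
  shows "(\<lambda>x. x \<bullet> L x) \<in> polys 2"
proof -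
  have "(\<lambda>x. \<Sum>b\<in>Basis. (x \<bullet> b) * (x \<bullet> adjoint L b)) \<in> polys (1 + 1)"
    using polys_inner_power[of 1 1] by (intro polys_sum polys_mult) simp_all
  also have "(\<lambda>x. \<Sum>b\<in>Basis. (x \<bullet> b) * (x \<bullet> adjoint L b)) = (\<lambda>x. x \<bullet> L x)"
    by (subst (3) euclidean_inner) (simp add: adjoint_works[OF assms])
  finally show ?thesis
    by (simp add: numeral_2_eq_2)
qed

lemma polys_norm_linear_power2:
  fixes L :: "'a::euclidean_space \<Rightarrow> 'b::euclidean_space"
  assumes "linear L"
  shows "(\<lambda>x. (norm (L x))\<^sup>2) \<in> polys 2"
  using polys_quadratic_form[OF linear_compose[OF assms adjoint_linear[OF assms]]]
  by (simp add: adjoint_works[OF assms] power2_norm_eq_inner)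

lemma polys_continuous_on: "p \<in> polys t \<Longrightarrow> continuous_on A p"
  by (induction rule: polys_induct) (intro continuous_intros | assumption)+

lemma sphere_polys_mono: "f \<in> sphere_polys s \<Longrightarrow> s \<le> t \<Longrightarrow> f \<in> sphere_polys t"
  unfolding sphere_polys_def using polys_mono by blast

lemma polys_imp_sphere_polys: "f \<in> polys t \<Longrightarrow> f \<in> sphere_polys t"
  unfolding sphere_polys_def by blast

section \<open>Rotation invariance of the sphere measure\<close>

lemma nn_integral_lborel_reflect:
  fixes h :: "'a::euclidean_space \<Rightarrow> ennreal"
  assumes [measurable]: "h \<in> borel_measurable borel"
  shows "(\<integral>\<^sup>+x. h (c - x) \<partial>lborel) = (\<integral>\<^sup>+x. h x \<partial>lborel)"
proof -
  have "(\<integral>\<^sup>+x. h x \<partial>lborel)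
    = (\<integral>\<^sup>+x. h x \<partial>density (distr lborel borel (\<lambda>x. c + (- 1) *\<^sub>R x)) (\<lambda>_. ennreal (\<bar>- 1\<bar> ^ DIM('a))))"
    by (subst lborel_affine[of "- 1" c]) auto
  also have "\<dots> = (\<integral>\<^sup>+x. h (c - x) \<partial>lborel)"
    by (simp add: density_1 nn_integral_distr)
  finally show ?thesis ..
qed

lemma nn_integral_lborel_plus:
  fixes h :: "'a::euclidean_space \<Rightarrow> ennreal"
  assumes [measurable]: "h \<in> borel_measurable borel"
  shows "(\<integral>\<^sup>+x. h (x + c) \<partial>lborel) = (\<integral>\<^sup>+x. h x \<partial>lborel)"
  by (subst lborel_distr_plus[of c, symmetric]) (simp add: nn_integral_distr add.commute)

text \<open>Source and target are separate types: besides rotations of one space this covers the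
  identification of \<open>'k ^ 'n\<close> with \<open>'k \<times> 'k\<close> when there are two
  coordinates.\<close>

locale linear_isometry =
  fixes T :: "'a::euclidean_space \<Rightarrow> 'b::euclidean_space"
  assumes linear: "linear T" and norm: "norm (T x) = norm x" and surj: "surj T"
begin

lemma measurable_T [measurable]: "T \<in> borel_measurable borel"
  using linear by (intro borel_measurable_continuous_onI linear_continuous_on)
    (simp add: linear_linear)

text \<open>Weil's uniqueness argument for Haar measure: both measures are translation invariant, and
  integrating \<^term>\<open>f (T x + y) * g y\<close> in both orders shows that they are proportional.\<close>

lemma lborel_distr: "distr lborel borel T = lborel"
proof -
  have proportional: "(\<integral>\<^sup>+x. f (T x) \<partial>lborel) * (\<integral>\<^sup>+y. g y \<partial>lborel)
      = (\<integral>\<^sup>+y. f y \<partial>lborel) * (\<integral>\<^sup>+x. g (T x) \<partial>lborel)"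
    if [measurable]: "f \<in> borel_measurable borel" "g \<in> borel_measurable borel"
    for f g :: "'b \<Rightarrow> ennreal"
  proof -
    \<comment> \<open>Surjectivity turns translations and reflections of the target into those of
      the source, where \<open>lborel\<close> is known to be invariant.\<close>
    have shift: "T (x + inv T y) = T x + y" "T (inv T y - x) = y - T x" for x y
      using surj by (simp_all add: linear_add[OF linear] linear_diff[OF linear] surj_f_inv_f)
    have "(\<integral>\<^sup>+x. f (T x) \<partial>lborel) * (\<integral>\<^sup>+y. g y \<partial>lborel)
        = (\<integral>\<^sup>+y. (\<integral>\<^sup>+x. f (T x) \<partial>lborel) * g y \<partial>lborel)"
      by (simp add: nn_integral_cmult)
    also have "\<dots> = (\<integral>\<^sup>+y. (\<integral>\<^sup>+x. f (T x + y) \<partial>lborel) * g y \<partial>lborel)"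
      using nn_integral_lborel_plus[of "\<lambda>x. f (T x)" "inv T _"] by (simp add: shift)
    also have "\<dots> = (\<integral>\<^sup>+y. (\<integral>\<^sup>+x. f (T x + y) * g y \<partial>lborel) \<partial>lborel)"
      by (simp add: nn_integral_multc)
    also have "\<dots> = (\<integral>\<^sup>+x. (\<integral>\<^sup>+y. f (T x + y) * g y \<partial>lborel) \<partial>lborel)"
      by (rule lborel_pair.Fubini') measurable
    also have "\<dots> = (\<integral>\<^sup>+x. (\<integral>\<^sup>+y. f y * g (y - T x) \<partial>lborel) \<partial>lborel)"
      using nn_integral_lborel_plus[of "\<lambda>y. f y * g (y - T x)" "T x" for x]
      by (simp add: add.commute)
    also have "\<dots> = (\<integral>\<^sup>+y. (\<integral>\<^sup>+x. f y * g (y - T x) \<partial>lborel) \<partial>lborel)"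
      by (rule lborel_pair.Fubini'[symmetric]) measurable
    also have "\<dots> = (\<integral>\<^sup>+y. f y * (\<integral>\<^sup>+x. g (y - T x) \<partial>lborel) \<partial>lborel)"
      by (simp add: nn_integral_cmult)
    also have "\<dots> = (\<integral>\<^sup>+y. f y * (\<integral>\<^sup>+x. g (T x) \<partial>lborel) \<partial>lborel)"
      using nn_integral_lborel_reflect[of "\<lambda>x. g (T x)" "inv T _"] by (simp add: shift)
    also have "\<dots> = (\<integral>\<^sup>+y. f y \<partial>lborel) * (\<integral>\<^sup>+x. g (T x) \<partial>lborel)"
      by (simp add: nn_integral_multc)
    finally show ?thesis .
  qed
  \<comment> \<open>The factor of proportionality is found from the unit ball: T pulls the ball back
    to the ball, and equal dimensions give both balls the same finite nonzero volume.\<close>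
  have "inj T"
    using linear_injective_0[OF linear] norm by (metis norm_eq_zero)
  then have DIM: "DIM('a) = DIM('b)"
    using linear surj by (metis dim_UNIV dim_image_eq inj_on_subset top_greatest)
  have pre: "(\<lambda>x. indicator (ball 0 1) (T x) :: ennreal) = indicator (ball 0 1)"
    by (auto simp: norm indicator_def fun_eq_iff)
  have ball: "emeasure lborel (ball 0 1 :: 'a set) = emeasure lborel (ball 0 1 :: 'b set)"
    by (simp add: emeasure_ball DIM)
  have nz: "emeasure lborel (ball 0 1 :: 'b set) \<noteq> 0" "emeasure lborel (ball 0 1 :: 'b set) \<noteq> \<infinity>"
    using content_ball_pos[of 1 "0 :: 'b"] emeasure_lborel_ball_finite[of "0 :: 'b" 1]
    by (auto simp: measure_def)
  show ?thesis
  proof (rule measure_eqI)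
    fix A assume "A \<in> sets (distr lborel borel T)"
    then have [measurable]: "A \<in> sets borel"
      by simp
    have "(\<integral>\<^sup>+x. indicator A (T x) \<partial>lborel) = (\<integral>\<^sup>+x. indicator A x \<partial>distr lborel borel T)"
      by (subst nn_integral_distr) auto
    then have emA: "(\<integral>\<^sup>+x. indicator A (T x) \<partial>lborel) = emeasure (distr lborel borel T) A"
      by simp
    have [measurable]: "indicator (ball 0 1 :: 'b set) \<in> borel_measurable (borel :: 'b measure)"
      by (rule borel_measurable_indicator) simp
    have "emeasure (distr lborel borel T) A * emeasure lborel (ball 0 1 :: 'b set)
      = emeasure lborel A * emeasure lborel (ball 0 1 :: 'b set)"
      using proportional[of "indicator A" "indicator (ball 0 1)"]
      by (simp add: pre ball emA)
    with nz show "emeasure (distr lborel borel T) A = emeasure lborel A"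
      by (simp add: mult.commute[of _ "emeasure lborel (ball 0 1)"] ennreal_mult_cancel_left)
  qed simp
qed

lemma uniform_ball_distr:
  "distr (uniform_measure lborel (ball 0 1)) borel T = uniform_measure lborel (ball 0 1)"
proof (rule measure_eqI)
  fix A assume "A \<in> sets (distr (uniform_measure lborel (ball 0 1)) borel T)"
  then have A [measurable]: "A \<in> sets borel"
    by simp
  have *: "emeasure lborel B = emeasure lborel (T -` B)" if "B \<in> sets borel" for B
    by (subst lborel_distr[symmetric]) (simp add: emeasure_distr that)
  have pre: "T -` ball 0 1 = ball 0 1"
    by (auto simp: norm)
  have [measurable]: "T -` A \<in> sets borel"
    using measurable_sets_borel[OF measurable_T A] by simp
  show "emeasure (distr (uniform_measure lborel (ball 0 1)) borel T) A
    = emeasure (uniform_measure lborel (ball 0 1)) A"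
    by (simp add: emeasure_distr * pre)
qed simp

end

text \<open>The indicator removes the centre of the ball, which division by the norm sends to 0 and
  not onto the sphere.\<close>

lemma integral_sphere_measure:
  fixes f :: "'a::euclidean_space \<Rightarrow> real"
  assumes [measurable]: "f \<in> borel_measurable borel"
  shows "integral\<^sup>L sphere_measure f = (\<integral>x. indicator (sphere 0 1) (x /\<^sub>R norm x) * f (x /\<^sub>R norm x)
    \<partial>uniform_measure lborel (ball 0 1))"
proof -
  have [measurable]: "(\<lambda>x. indicator (sphere 0 1) x * f x) \<in> borel_measurable borel"
    by (intro borel_measurable_times borel_measurable_indicator) auto
  show ?thesis
    unfolding sphere_measure_def
    by (subst integral_restrict_space)
      (simp_all add: integral_distr[where f="\<lambda>x. indicator (sphere 0 1) x * f x"])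
qed

text \<open>A linear isometry commutes with radial projection and preserves the uniform distribution
  on the ball.\<close>

lemma (in linear_isometry) integral_sphere_measure_isometry:
  fixes f :: "'b \<Rightarrow> real"
  assumes [measurable]: "f \<in> borel_measurable borel"
  shows "(\<integral>x. f (T x) \<partial>sphere_measure) = integral\<^sup>L sphere_measure f"
proof -
  let ?g = "\<lambda>x. indicator (sphere 0 1) (x /\<^sub>R norm x) * f (x /\<^sub>R norm x)"
  have "(\<lambda>x. indicator (sphere 0 1) x * f x) \<in> borel_measurable borel"
    by (intro borel_measurable_times borel_measurable_indicator) auto
  then have [measurable]: "?g \<in> borel_measurable borel"
    by (rule measurable_compose[rotated]) measurable
  have "integral\<^sup>L sphere_measure f
      = (\<integral>x. ?g x \<partial>distr (uniform_measure lborel (ball 0 1)) borel T)"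
    by (simp add: integral_sphere_measure uniform_ball_distr)
  also have "\<dots> = (\<integral>x. ?g (T x) \<partial>uniform_measure lborel (ball 0 1))"
    by (subst integral_distr) simp_all
  also have "\<dots> = (\<integral>x. f (T x) \<partial>sphere_measure)"
    by (subst integral_sphere_measure)
      (simp_all add: norm linear_cmul[OF linear] indicator_def flip: linear_cmul[OF linear])
  finally show ?thesis ..
qed

interpretation sphere_measure: prob_space "sphere_measure :: 'a::euclidean_space measure"
  by (rule prob_space_sphere_measure)

lemma measurable_sphere_measure:
  "f \<in> measurable borel M \<Longrightarrow> f \<in> measurable sphere_measure M"
  unfolding sphere_measure_def by (intro measurable_restrict_space1) simp

lemma integral_sphere_cong:
  "(\<And>x. norm x = 1 \<Longrightarrow> f x = g x) \<Longrightarrow> integral\<^sup>L sphere_measure f = integral\<^sup>L sphere_measure g"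
  by (rule Bochner_Integration.integral_cong) (auto simp: space_sphere_measure)

lemma integrable_sphere_measure:
  fixes f :: "'a::euclidean_space \<Rightarrow> real"
  assumes "continuous_on UNIV f"
  shows "integrable sphere_measure f"
proof -
  have "compact (f ` sphere 0 1)"
    by (intro compact_continuous_image continuous_on_subset[OF assms]) auto
  then have "bounded (f ` sphere 0 1)"
    by (rule compact_imp_bounded)
  then obtain B where B: "\<And>x. x \<in> sphere 0 1 \<Longrightarrow> norm (f x) \<le> B"
    unfolding bounded_iff by blast
  have "AE x in sphere_measure. norm (f x) \<le> B"
    by (rule AE_I2, rule B) (simp only: space_sphere_measure)
  then show ?thesis
    by (rule sphere_measure.integrable_const_bound)
      (rule measurable_sphere_measure[OF borel_measurable_continuous_onI[OF assms]])
qed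

lemma sphere_measure_Fubini:
  fixes F :: "'a::euclidean_space \<Rightarrow> 'b::euclidean_space \<Rightarrow> real"
  assumes "continuous_on UNIV (case_prod F)"
  shows "(\<integral>y. (\<integral>x. F x y \<partial>sphere_measure) \<partial>sphere_measure)
    = (\<integral>x. (\<integral>y. F x y \<partial>sphere_measure) \<partial>sphere_measure)"
proof -
  interpret P: pair_prob_space "sphere_measure :: 'a measure" "sphere_measure :: 'b measure" ..
  have "compact (case_prod F ` (sphere 0 1 \<times> sphere 0 1))"
    by (intro compact_continuous_image continuous_on_subset[OF assms] compact_Times) auto
  then have "bounded (case_prod F ` (sphere 0 1 \<times> sphere 0 1))"
    by (rule compact_imp_bounded)
  then obtain B where B: "\<And>p. p \<in> sphere 0 1 \<times> sphere 0 1 \<Longrightarrow> norm (case_prod F p) \<le> B"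
    unfolding bounded_iff by blast
  have id: "(\<lambda>x. x) \<in> measurable sphere_measure (borel :: 'c::euclidean_space measure)"
    by (rule measurable_sphere_measure) simp
  have F: "case_prod F \<in> borel_measurable (borel \<Otimes>\<^sub>M borel)"
    unfolding borel_prod by (rule borel_measurable_continuous_onI[OF assms])
  have "(\<lambda>p. (fst p, snd p)) \<in> measurable (sphere_measure \<Otimes>\<^sub>M sphere_measure) (borel \<Otimes>\<^sub>M borel)"
    by (rule measurable_Pair; rule measurable_compose[OF _ id]) (rule measurable_fst measurable_snd)+
  from measurable_compose[OF this F]
  have meas: "case_prod F \<in> borel_measurable (sphere_measure \<Otimes>\<^sub>M sphere_measure)"
    by (simp only: prod.collapse)
  have "AE p in sphere_measure \<Otimes>\<^sub>M sphere_measure. norm (case_prod F p) \<le> B"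
    by (rule AE_I2, rule B) (simp only: space_pair_measure space_sphere_measure)
  then have "integrable (sphere_measure \<Otimes>\<^sub>M sphere_measure) (case_prod F)"
    by (rule P.integrable_const_bound[OF _ meas])
  then show ?thesis
    by (rule P.Fubini_integral)
qed

section \<open>Moments of linear forms on the sphere\<close>

definition sphere_moment :: "'a::euclidean_space itself \<Rightarrow> nat \<Rightarrow> real" where
  "sphere_moment _ j = (\<integral>x. (x \<bullet> (SOME b. b \<in> Basis)) ^ j \<partial>(sphere_measure :: 'a measure))"

lemma continuous_on_inner_power: "continuous_on A (\<lambda>x. (x \<bullet> u) ^ j)"
  by (intro continuous_intros)

lemmas measurable_inner_power [measurable] = borel_measurable_continuous_onI[OF continuous_on_inner_power]

lemma reflection:
  fixes a b :: "'a::euclidean_space"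
  assumes "norm a = norm b"
  obtains T where "linear_isometry T" "\<And>x. T x \<bullet> a = x \<bullet> b"
proof
  define v where "v = a - b"
  \<comment> \<open>Reflection in the hyperplane orthogonal to a - b. If a = b, the quotient is a
    division by zero with value 0, so T is the identity.\<close>
  define T where "T x = x - (2 * (x \<bullet> v) / (v \<bullet> v)) *\<^sub>R v" for x
  have "norm (T x) = norm x" for x
  proof -
    define c where "c = 2 * (x \<bullet> v) / (v \<bullet> v)"
    have "c * (v \<bullet> v) = 2 * (x \<bullet> v)"
      by (simp add: c_def)
    then have "T x \<bullet> T x = x \<bullet> x"
      by (simp add: T_def inner_diff_left inner_diff_right inner_commute[of v x] flip: c_def)
    then show ?thesis
      by (simp add: norm_eq_sqrt_inner)
  qed
  moreover have "linear T"
    by (intro linearI)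
      (simp_all add: T_def inner_add_left distrib_left add_divide_distrib scaleR_add_left scaleR_diff_right)
  ultimately have "orthogonal_transformation T"
    by (simp add: orthogonal_transformation)
  then show "linear_isometry T"
    using orthogonal_transformation_surj[of T]
    by (auto simp: linear_isometry_def orthogonal_transformation)
  have "2 * (v \<bullet> a) = v \<bullet> v"
    using assms by (simp add: v_def inner_diff_left inner_diff_right inner_commute norm_eq)
  then have "2 * (x \<bullet> v) / (v \<bullet> v) * (v \<bullet> a) = x \<bullet> v" for x
  proof (cases "v = 0")
    case False
    then have "v \<bullet> v \<noteq> 0"
      by simp
    with \<open>2 * (v \<bullet> a) = v \<bullet> v\<close> show ?thesis
      by (simp add: divide_simps)
  qed simp
  then show "T x \<bullet> a = x \<bullet> b" for x
    by (simp add: T_def inner_diff_left) (simp add: v_def inner_diff_right)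
qed

text \<open>A reflection exchanges u with its norm times the basis vector chosen in
  \<open>sphere_moment\<close>, so that choice is immaterial.\<close>

lemma integral_sphere_power:
  "(\<integral>x. (x \<bullet> u) ^ j \<partial>sphere_measure) = sphere_moment TYPE('a) j * norm u ^ j"
  for u :: "'a::euclidean_space"
proof -
  define e where "e = (SOME b. b \<in> (Basis :: 'a set))"
  have "e \<in> Basis"
    unfolding e_def by (rule someI_ex) (use nonempty_Basis in blast)
  then obtain T where T: "linear_isometry T" "\<And>x. T x \<bullet> (norm u *\<^sub>R e) = x \<bullet> u"
    by (metis abs_norm_cancel mult_cancel_left2 norm_Basis norm_scaleR reflection)
  have "(\<integral>x. (x \<bullet> u) ^ j \<partial>sphere_measure) = (\<integral>x. (T x \<bullet> (norm u *\<^sub>R e)) ^ j \<partial>sphere_measure)"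
    by (simp only: T(2))
  also have "\<dots> = (\<integral>x. (x \<bullet> (norm u *\<^sub>R e)) ^ j \<partial>sphere_measure)"
    by (rule linear_isometry.integral_sphere_measure_isometry[OF T(1)]) measurable
  also have "\<dots> = sphere_moment TYPE('a) j * norm u ^ j"
    by (simp add: sphere_moment_def e_def power_mult_distrib)
  finally show ?thesis .
qed

lemma sphere_moment_odd: "odd j \<Longrightarrow> sphere_moment TYPE('a::euclidean_space) j = 0"
proof -
  assume "odd j"
  interpret linear_isometry "uminus :: 'a \<Rightarrow> 'a"
  proof
    show "surj (uminus :: 'a \<Rightarrow> 'a)"
      by (metis surjI minus_minus)
  qed (simp_all add: linear_iff)
  show ?thesis
    using integral_sphere_measure_isometry[of "\<lambda>x. (x \<bullet> (SOME b. b \<in> Basis)) ^ j"] \<open>odd j\<close>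
    by (simp add: sphere_moment_def)
qed

lemma linear_isometry_endo:
  fixes T :: "'a::euclidean_space \<Rightarrow> 'a"
  assumes "linear T" "\<And>x. norm (T x) = norm x"
  shows "linear_isometry T"
proof (rule linear_isometry.intro)
  show "surj T"
    using assms by (intro orthogonal_transformation_surj) (simp add: orthogonal_transformation)
qed (fact assms)+

text \<open>Both sides are the double integral of (x z . u)^j over the two spheres. Integrating over
  z first gives the moment times |adj x u|^j; integrating over x first gives a value independent of
  z, since multiplication by a unit z is an isometry. Multiplicativity of the norm suffices here, so
  the octonions are covered.\<close>

lemma integral_fibre_averages:
  fixes mul :: "'e::euclidean_space \<Rightarrow> 'k::euclidean_space \<Rightarrow> 'e"
  assumes "bounded_bilinear mul" and norm_mul: "\<And>x z. norm (mul x z) = norm x * norm z"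
    and inner_mul: "\<And>x z u. inner (mul x z) u = inner z (adj x u)"
  shows "sphere_moment TYPE('k) j * (\<integral>x. norm (adj x u) ^ j \<partial>sphere_measure)
    = (\<integral>x. (x \<bullet> u) ^ j \<partial>sphere_measure)"
proof -
  interpret bounded_bilinear mul
    by fact
  have "sphere_moment TYPE('k) j * (\<integral>x. norm (adj x u) ^ j \<partial>sphere_measure)
      = (\<integral>x. (\<integral>z. (mul x z \<bullet> u) ^ j \<partial>sphere_measure) \<partial>sphere_measure)"
    by (simp add: inner_mul integral_sphere_power)
  also have "\<dots> = (\<integral>z. (\<integral>x. (mul x z \<bullet> u) ^ j \<partial>sphere_measure) \<partial>sphere_measure)"
    by (rule sphere_measure_Fubini[symmetric])
      (simp add: split_def, intro continuous_intros continuous_on)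
  also have "\<dots> = (\<integral>z. (\<integral>x. (x \<bullet> u) ^ j \<partial>sphere_measure) \<partial>(sphere_measure :: 'k measure))"
  proof (rule integral_sphere_cong)
    fix z :: 'k assume "norm z = 1"
    then have "linear_isometry (\<lambda>x. mul x z)"
      by (intro linear_isometry_endo bounded_linear.linear bounded_linear_left) (simp add: norm_mul)
    then show "(\<integral>x. (mul x z \<bullet> u) ^ j \<partial>sphere_measure) = (\<integral>x. (x \<bullet> u) ^ j \<partial>sphere_measure)"
      by (rule linear_isometry.integral_sphere_measure_isometry) (rule measurable_inner_power)
  qed
  also have "\<dots> = (\<integral>x. (x \<bullet> u) ^ j \<partial>sphere_measure)"
    by (simp add: sphere_measure.prob_space)
  finally show ?thesis .
qed

section \<open>Designs along a fibration\<close>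

lemma sphere_polys_const: "(\<lambda>_. c) \<in> sphere_polys t"
  by (intro polys_imp_sphere_polys polys_const)

lemma weighted_design_sum_weights:
  assumes "weighted_design \<mu> P t X w" "(\<lambda>_. 1) \<in> P t" "prob_space \<mu>"
  shows "sum w X = 1"
proof -
  interpret prob_space \<mu>
    by fact
  have "(\<Sum>x\<in>X. w x * 1) = integral\<^sup>L \<mu> (\<lambda>_. 1)"
    using assms(1,2) by (simp add: weighted_design_def del: mult_1_right)
  then show ?thesis
    by (simp add: prob_space)
qed

text \<open>Testing on the constant 1 makes the weights sum to 1, which excludes the empty
  set.\<close>

lemma unweighted_design_0:
  assumes "weighted_design \<mu> P 0 X w" "(\<lambda>_. 1) \<in> P 0" "prob_space \<mu>"
  shows "finite X" "X \<noteq> {}" "X \<subseteq> space \<mu>"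
  using assms weighted_design_sum_weights[OF assms] by (auto simp: weighted_design_def)

lemmas sphere_design_0 = unweighted_design_0[OF _ sphere_polys_const prob_space_sphere_measure]

lemmas sphere_design_sum_weights =
  weighted_design_sum_weights[OF _ sphere_polys_const prob_space_sphere_measure]

text \<open>The map \<^term>\<open>mul\<close> is right multiplication by scalars and \<^term>\<open>adj x\<close> is the adjoint of
  \<^term>\<open>mul x\<close>.  Averaging \<^term>\<open>\<lambda>x. inner x u ^ (2 * m)\<close> over the fibre through a base point
  \<^term>\<open>z\<close> yields a multiple of \<^term>\<open>norm (adj z u) ^ (2 * m)\<close>, so the last assumption says that
  fibre averages of polynomials descend to polynomials of half the degree.\<close>

locale fibration =
  fixes mul :: "'e::euclidean_space \<Rightarrow> 'k::euclidean_space \<Rightarrow> 'e"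
    and adj :: "'e \<Rightarrow> 'e \<Rightarrow> 'k"
    and \<pi> :: "'e \<Rightarrow> 'b"
    and \<mu> :: "'b measure"
    and P :: "nat \<Rightarrow> ('b \<Rightarrow> real) set"
  assumes norm_mul: "norm (mul x z) = norm x * norm z"
    and inner_mul: "inner (mul x z) u = inner z (adj x u)"
    and prob: "prob_space \<mu>"
    and one: "(\<lambda>_. 1) \<in> P 0"
    and mono: "f \<in> P s \<Longrightarrow> s \<le> t \<Longrightarrow> f \<in> P t"
    and pullback: "f \<in> P s \<Longrightarrow> (\<lambda>x. f (\<pi> x)) \<in> sphere_polys (2 * s)"
    and integral_pullback: "f \<in> P s \<Longrightarrow> (\<integral>x. f (\<pi> x) \<partial>sphere_measure) = integral\<^sup>L \<mu> f"
    and fibre_average: "\<exists>g. (\<forall>m. (\<lambda>y. g y ^ m) \<in> P m) \<and>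
      (\<forall>z\<in>sphere 0 1. (\<forall>\<zeta>\<in>sphere 0 1. \<pi> (mul z \<zeta>) = \<pi> z) \<longrightarrow> (norm (adj z u))\<^sup>2 = g (\<pi> z)) \<and>
      (\<forall>m. sphere_moment TYPE('k) (2 * m) * (\<integral>x. g (\<pi> x) ^ m \<partial>sphere_measure)
        = (\<integral>x. (x \<bullet> u) ^ (2 * m) \<partial>sphere_measure))"

text \<open>The point sets are kept apart from the weights, so that the weighted and unweighted
  statements share them. The last clause on base points demands that all unit translates stay in the
  fibre.\<close>

locale fibred_points = fibration +
  fixes Y Z zb X
  assumes Y: "finite Y" "Y \<noteq> {}" "Y \<subseteq> space \<mu>"
    and Z: "y \<in> Y \<Longrightarrow> finite (Z y)" "y \<in> Y \<Longrightarrow> Z y \<noteq> {}" "y \<in> Y \<Longrightarrow> Z y \<subseteq> sphere 0 1"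
    and base: "y \<in> Y \<Longrightarrow> norm (zb y) = 1" "y \<in> Y \<Longrightarrow> \<pi> (zb y) = y"
      "y \<in> Y \<Longrightarrow> norm \<zeta> = 1 \<Longrightarrow> \<pi> (mul (zb y) \<zeta>) = y"
    and X: "X = (\<Union>y\<in>Y. mul (zb y) ` Z y)"
begin

text \<open>Linearity of \<open>mul (zb y)\<close> comes from the existence of an adjoint;
  multiplicativity of the norm then gives a trivial kernel.\<close>

lemma inj_mul: "y \<in> Y \<Longrightarrow> inj (mul (zb y))"
proof (rule injI)
  fix z z' assume y: "y \<in> Y" and eq: "mul (zb y) z = mul (zb y) z'"
  have "inner (mul (zb y) (z - z')) u = 0" for u
    using arg_cong[OF eq, of "\<lambda>v. inner v u"] by (simp add: inner_mul inner_diff_left)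
  then have "mul (zb y) (z - z') = 0"
    by (metis inner_eq_zero_iff)
  then show "z = z'"
    using norm_mul[of "zb y" "z - z'"] base(1)[OF y] by simp
qed

lemma fibre: "y \<in> Y \<Longrightarrow> z \<in> Z y \<Longrightarrow> \<pi> (mul (zb y) z) = y"
  using Z(3) base(3) by (force simp: subset_iff)

lemma disjoint: "y \<in> Y \<Longrightarrow> y' \<in> Y \<Longrightarrow> y \<noteq> y' \<Longrightarrow> mul (zb y) ` Z y \<inter> mul (zb y') ` Z y' = {}"
  by (auto simp: disjoint_iff) (metis fibre)

lemma sum_X: "sum F X = (\<Sum>y\<in>Y. \<Sum>z\<in>Z y. F (mul (zb y) z))"
proof -
  have "sum F X = (\<Sum>y\<in>Y. sum F (mul (zb y) ` Z y))"
    unfolding X using Y(1) Z(1) disjoint by (intro sum.UNION_disjoint) auto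
  also have "\<dots> = (\<Sum>y\<in>Y. \<Sum>z\<in>Z y. F (mul (zb y) z))"
    by (intro sum.cong refl) (simp add: sum.reindex inj_on_subset[OF inj_mul])
  finally show ?thesis .
qed

lemma card_X: "real (card X) = (\<Sum>y\<in>Y. real (card (Z y)))"
  using sum_X[of "\<lambda>_. 1 :: real"] by simp

lemma X_sphere: "finite X" "X \<subseteq> sphere 0 1"
  using Y(1) Z(1,3) by (auto simp: X norm_mul base(1) subset_iff)

lemma weighted_sum_X:
  fixes w F :: "_ \<Rightarrow> real"
  assumes "\<And>y z. y \<in> Y \<Longrightarrow> z \<in> Z y \<Longrightarrow> w (mul (zb y) z) = w\<^sub>Y y * w\<^sub>Z y z"
  shows "(\<Sum>x\<in>X. w x * F x) = (\<Sum>y\<in>Y. w\<^sub>Y y * (\<Sum>z\<in>Z y. w\<^sub>Z y z * F (mul (zb y) z)))"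
proof -
  have "(\<Sum>z\<in>Z y. w (mul (zb y) z) * F (mul (zb y) z))
      = w\<^sub>Y y * (\<Sum>z\<in>Z y. w\<^sub>Z y z * F (mul (zb y) z))" if "y \<in> Y" for y
    unfolding sum_distrib_left using that by (intro sum.cong refl) (simp only: assms mult.assoc)
  then show ?thesis
    unfolding sum_X by (intro sum.cong refl)
qed

text \<open>On the block over y the pullback of f is constant with value f y, and the block's inner
  weights sum to 1. The pullback has degree 2 * (t div 2), which is at most t.\<close>

lemma base_design:
  assumes w: "\<And>y z. y \<in> Y \<Longrightarrow> z \<in> Z y \<Longrightarrow> w (mul (zb y) z) = w\<^sub>Y y * w\<^sub>Z y z"
    and pos: "\<And>y. y \<in> Y \<Longrightarrow> w\<^sub>Y y > 0"
    and sum: "\<And>y. y \<in> Y \<Longrightarrow> sum (w\<^sub>Z y) (Z y) = 1"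
    and design: "sphere_design t X w"
  shows "weighted_design \<mu> P (t div 2) Y w\<^sub>Y"
proof -
  have "(\<Sum>y\<in>Y. w\<^sub>Y y * f y) = integral\<^sup>L \<mu> f" if f: "f \<in> P (t div 2)" for f
  proof -
    have "(\<Sum>y\<in>Y. w\<^sub>Y y * f y) = (\<Sum>y\<in>Y. w\<^sub>Y y * (\<Sum>z\<in>Z y. w\<^sub>Z y z * f (\<pi> (mul (zb y) z))))"
      using sum by (intro sum.cong refl) (simp add: fibre flip: sum_distrib_right)
    also have "\<dots> = (\<Sum>x\<in>X. w x * f (\<pi> x))"
      by (rule weighted_sum_X[of w w\<^sub>Y w\<^sub>Z, OF w, symmetric])
    also have "\<dots> = (\<integral>x. f (\<pi> x) \<partial>sphere_measure)"
      using design sphere_polys_mono[OF pullback[OF f], of t] by (simp add: weighted_design_def)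
    also have "\<dots> = integral\<^sup>L \<mu> f"
      by (rule integral_pullback[OF f])
    finally show ?thesis .
  qed
  with Y pos show ?thesis
    by (simp add: weighted_design_def)
qed

lemma total_design:
  assumes w: "\<And>y z. y \<in> Y \<Longrightarrow> z \<in> Z y \<Longrightarrow> w (mul (zb y) z) = w\<^sub>Y y * w\<^sub>Z y z"
    and designY: "weighted_design \<mu> P (t div 2) Y w\<^sub>Y"
    and designZ: "\<And>y. y \<in> Y \<Longrightarrow> sphere_design t (Z y) (w\<^sub>Z y)"
  shows "sphere_design t X w"
proof -
  have pow: "(\<Sum>x\<in>X. w x * (x \<bullet> u) ^ j) = (\<integral>x. (x \<bullet> u) ^ j \<partial>sphere_measure)" if j: "j \<le> t" for j u
  proof -
    \<comment> \<open>Here \<open>'b\<close> is the type of scalars, called \<open>'k\<close> in the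
      locale \<open>fibration\<close>.\<close>
    have fib: "(\<Sum>z\<in>Z y. w\<^sub>Z y z * (mul (zb y) z \<bullet> u) ^ j)
      = sphere_moment TYPE('b) j * norm (adj (zb y) u) ^ j" if y: "y \<in> Y" for y
    proof -
      have "(\<lambda>z. (z \<bullet> adj (zb y) u) ^ j) \<in> sphere_polys t"
        by (intro polys_imp_sphere_polys polys_inner_power j)
      then have "(\<Sum>z\<in>Z y. w\<^sub>Z y z * (z \<bullet> adj (zb y) u) ^ j)
          = (\<integral>z. (z \<bullet> adj (zb y) u) ^ j \<partial>sphere_measure)"
        using designZ[OF y] by (simp add: weighted_design_def)
      then show ?thesis
        by (simp add: inner_mul integral_sphere_power)
    qed
    have "(\<Sum>x\<in>X. w x * (x \<bullet> u) ^ j)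
        = (\<Sum>y\<in>Y. w\<^sub>Y y * (\<Sum>z\<in>Z y. w\<^sub>Z y z * (mul (zb y) z \<bullet> u) ^ j))"
      by (rule weighted_sum_X[of w w\<^sub>Y w\<^sub>Z, OF w])
    also have "\<dots> = sphere_moment TYPE('b) j * (\<Sum>y\<in>Y. w\<^sub>Y y * norm (adj (zb y) u) ^ j)"
      unfolding sum_distrib_left
      by (intro sum.cong refl) (simp add: fib flip: sum_distrib_left)
    also have "\<dots> = (\<integral>x. (x \<bullet> u) ^ j \<partial>sphere_measure)"
    \<comment> \<open>For odd j the moments of both the fibre sphere and the total sphere vanish.
      For j = 2m the fibre averages involve g^m, and m is at most t div 2.\<close>
    proof (cases "even j")
      case False
      then show ?thesis
        by (simp add: sphere_moment_odd integral_sphere_power)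
    next
      case True
      then obtain m where m: "j = 2 * m"
        by blast
      obtain g where g: "\<And>m. (\<lambda>y. g y ^ m) \<in> P m"
        and adj: "\<forall>z\<in>sphere 0 1. (\<forall>\<zeta>\<in>sphere 0 1. \<pi> (mul z \<zeta>) = \<pi> z) \<longrightarrow>
          (norm (adj z u))\<^sup>2 = g (\<pi> z)"
        and int: "\<And>m. sphere_moment TYPE('b) (2 * m) * (\<integral>x. g (\<pi> x) ^ m \<partial>sphere_measure)
          = (\<integral>x. (x \<bullet> u) ^ (2 * m) \<partial>sphere_measure)"
        using fibre_average[of u] by blast
      have "norm (adj (zb y) u) ^ j = g y ^ m" if "y \<in> Y" for y
        using bspec[OF adj, of "zb y"] base that by (simp add: m power_mult)
      then have "(\<Sum>y\<in>Y. w\<^sub>Y y * norm (adj (zb y) u) ^ j) = (\<Sum>y\<in>Y. w\<^sub>Y y * g y ^ m)"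
        by simp
      also have "\<dots> = integral\<^sup>L \<mu> (\<lambda>y. g y ^ m)"
        using designY mono[OF g, of m "t div 2"] j m by (simp add: weighted_design_def)
      also have "\<dots> = (\<integral>x. g (\<pi> x) ^ m \<partial>sphere_measure)"
        by (rule integral_pullback[OF g, symmetric])
      finally show ?thesis
        using int by (simp add: m)
    qed
    finally show ?thesis .
  qed
  have polys: "(\<Sum>x\<in>X. w x * p x) = integral\<^sup>L sphere_measure p" if "p \<in> polys t" for p
    using that
  proof (induction rule: polys_induct)
    case (pow j u)
    then show ?case
      by (rule \<open>\<And>u j. j \<le> t \<Longrightarrow> _ u j\<close>)
  next
    case (add f g)
    then have "integrable sphere_measure f" "integrable sphere_measure g"
      by (auto intro: integrable_sphere_measure polys_continuous_on)
    with add.IH show ?case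
      by (simp add: distrib_left sum.distrib)
  next
    case (scale f c)
    then show ?case
      by (simp add: mult.left_commute[of _ c] flip: sum_distrib_left)
  qed
  have "(\<Sum>x\<in>X. w x * f x) = integral\<^sup>L sphere_measure f" if "f \<in> sphere_polys t" for f
  proof -
    from that obtain p where p: "p \<in> polys t" "\<And>x. norm x = 1 \<Longrightarrow> f x = p x"
      by (auto simp: sphere_polys_def)
    have "(\<Sum>x\<in>X. w x * f x) = (\<Sum>x\<in>X. w x * p x)"
      using X_sphere(2) p(2) by (intro sum.cong refl) (auto simp: subset_iff)
    also have "\<dots> = integral\<^sup>L sphere_measure f"
      unfolding polys[OF p(1)] by (intro integral_sphere_cong) (simp add: p(2))
    finally show ?thesis .
  qed
  moreover have "\<forall>x\<in>X. w x > 0"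
    using designY designZ w by (auto simp: X weighted_design_def)
  ultimately show ?thesis
    using X_sphere by (simp add: weighted_design_def space_sphere_measure)
qed

context
  fixes N assumes N: "\<And>y. y \<in> Y \<Longrightarrow> card (Z y) = N"
begin

text \<open>With N points in every fibre, X has N times as many points as Y, so its constant weight
  is a product as the weighted statements require.\<close>

lemma card_factor: "1 / real (card X) = (1 / real (card Y)) * (1 / real (card (Z y)))" if "y \<in> Y"
  using card_X N that by simp

lemma unweighted_base_design:
  assumes "unweighted_sphere_design t X"
  shows "unweighted_design \<mu> P (t div 2) Y"
  unfolding unweighted_design_def
proof (rule base_design)
  show "sphere_design t X (\<lambda>_. 1 / real (card X))"
    using assms by (simp add: unweighted_design_def)
  show "1 / real (card X) = (1 / real (card Y)) * (1 / real (card (Z y)))" if "y \<in> Y" for y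
    using that by (rule card_factor)
qed (use Y Z in \<open>auto simp: card_gt_0_iff\<close>)

lemma unweighted_total_design:
  assumes "unweighted_design \<mu> P (t div 2) Y" "\<And>y. y \<in> Y \<Longrightarrow> unweighted_sphere_design t (Z y)"
  shows "unweighted_sphere_design t X"
  unfolding unweighted_design_def
proof (rule total_design)
  show "weighted_design \<mu> P (t div 2) Y (\<lambda>_. 1 / real (card Y))"
    using assms(1) by (simp add: unweighted_design_def)
  show "sphere_design t (Z y) (\<lambda>_. 1 / real (card (Z y)))" if "y \<in> Y" for y
    using assms(2)[OF that] by (simp add: unweighted_design_def)
  show "1 / real (card X) = (1 / real (card Y)) * (1 / real (card (Z y)))" if "y \<in> Y" for y
    using that by (rule card_factor)
qed

end

end

context fibration
begin

lemma designs:
  assumes Y0: "weighted_design \<mu> P 0 Y w\<^sub>Y"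
    and Z0: "\<And>y. y \<in> Y \<Longrightarrow> sphere_design 0 (Z y) (w\<^sub>Z y)"
    and base: "\<And>y. y \<in> Y \<Longrightarrow> norm (zb y) = 1" "\<And>y. y \<in> Y \<Longrightarrow> \<pi> (zb y) = y"
      "\<And>y \<zeta>. y \<in> Y \<Longrightarrow> norm \<zeta> = 1 \<Longrightarrow> \<pi> (mul (zb y) \<zeta>) = y"
    and X: "X = (\<Union>y\<in>Y. {mul (zb y) z | z. z \<in> Z y})"
    and w: "\<And>y z. y \<in> Y \<Longrightarrow> z \<in> Z y \<Longrightarrow> w (mul (zb y) z) = w\<^sub>Y y * w\<^sub>Z y z"
  shows "(sphere_design t X w \<longrightarrow> weighted_design \<mu> P (t div 2) Y w\<^sub>Y) \<and>
    (weighted_design \<mu> P (t div 2) Y w\<^sub>Y \<and> (\<forall>y\<in>Y. sphere_design t (Z y) (w\<^sub>Z y)) \<longrightarrow>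
      sphere_design t X w) \<and>
    ((\<exists>N. \<forall>y\<in>Y. card (Z y) = N) \<longrightarrow>
      (unweighted_sphere_design t X \<longrightarrow> unweighted_design \<mu> P (t div 2) Y) \<and>
      (unweighted_design \<mu> P (t div 2) Y \<and> (\<forall>y\<in>Y. unweighted_sphere_design t (Z y)) \<longrightarrow>
        unweighted_sphere_design t X))"
proof -
  interpret fibred_points mul adj \<pi> \<mu> P Y Z zb X
  proof
    show "finite Y" "Y \<noteq> {}" "Y \<subseteq> space \<mu>"
      using unweighted_design_0[OF Y0 one prob] by auto
    show "finite (Z y)" "Z y \<noteq> {}" "Z y \<subseteq> sphere 0 1" if "y \<in> Y" for y
      using sphere_design_0[OF Z0[OF that]] by (auto simp: space_sphere_measure)
    show "X = (\<Union>y\<in>Y. mul (zb y) ` Z y)"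
      unfolding X by blast
  qed (use base in auto)
  have pos: "w\<^sub>Y y > 0" if "y \<in> Y" for y
    using Y0 that by (simp add: weighted_design_def)
  show ?thesis
    using base_design[of w w\<^sub>Y w\<^sub>Z, OF w pos sphere_design_sum_weights[OF Z0]] total_design[of w w\<^sub>Y w\<^sub>Z, OF w]
      unweighted_base_design unweighted_total_design
    by meson
qed

end

section \<open>The Hopf map\<close>

lemma hopf_map_eq: "hopf_map x = ((norm (fst x))\<^sup>2 - (norm (snd x))\<^sup>2, 2 *\<^sub>R (fst x * conjugate (snd x)))"
  by (simp add: hopf_map_def split_def)

text \<open>The functions \<^term>\<open>\<lambda>x. inner (hopf_map x) u\<close> are quadratic forms; their symmetric operators
  \<^term>\<open>hopf_op u\<close> form a Clifford system.\<close>

definition hopf_op :: "real \<times> 'k::rcho \<Rightarrow> 'k \<times> 'k \<Rightarrow> 'k \<times> 'k" where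
  "hopf_op u x = (fst u *\<^sub>R fst x + snd u * snd x, conjugate (snd u) * fst x - fst u *\<^sub>R snd x)"

lemma linear_hopf_op: "linear (hopf_op u)"
  by (intro linearI)
    (simp_all add: hopf_op_def rcho_mult_add rcho_mult_scaleR algebra_simps)

lemma inner_conjugate_mult: "inner (conjugate q * a) b = inner a (q * b)" for a b q :: "'a::rcho"
  by (simp add: inner_mult_right_rcho)

lemma inner_mult_conjugate: "inner (a * conjugate b) q = inner a (q * b)" for a b q :: "'a::rcho"
  by (simp add: inner_mult_left_rcho)

lemma norm_plus_power2: "(norm (x + y))\<^sup>2 = (norm x)\<^sup>2 + (norm y)\<^sup>2 + 2 * inner x y"
  for x y :: "'a::real_inner"
  by (simp add: power2_norm_eq_inner inner_add_left inner_add_right inner_commute)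

lemma norm_minus_power2: "(norm (x - y))\<^sup>2 = (norm x)\<^sup>2 + (norm y)\<^sup>2 - 2 * inner x y"
  for x y :: "'a::real_inner"
  by (simp add: power2_norm_eq_inner inner_diff_left inner_diff_right inner_commute)

lemma norm_pair_power2: "(norm x)\<^sup>2 = (norm (fst x))\<^sup>2 + (norm (snd x))\<^sup>2"
  for x :: "'a::real_inner \<times> 'b::real_inner"
  by (simp add: power2_norm_eq_inner inner_prod_def)

lemma inner_hopf_map: "inner (hopf_map x) u = inner x (hopf_op u x)"
proof -
  have "inner (snd x) (conjugate (snd u) * fst x) = inner (fst x) (snd u * snd x)"
    by (metis inner_commute inner_conjugate_mult)
  then show ?thesis
    by (simp add: hopf_map_eq hopf_op_def inner_prod_def inner_mult_conjugate
        power2_norm_eq_inner algebra_simps)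
qed

text \<open>This is A_u^2 = |u|^2 for the symmetric operator A_u, expressed by norms. The cross
  terms of the two components cancel by adjointness.\<close>

lemma norm_hopf_op: "norm (hopf_op u x) = norm u * norm x"
proof -
  have "(norm (hopf_op u x))\<^sup>2 = (norm u)\<^sup>2 * (norm x)\<^sup>2"
    by (simp add: norm_pair_power2 hopf_op_def norm_plus_power2 norm_minus_power2 norm_mult_rcho
        inner_conjugate_mult inner_commute[of "snd u * snd x"] algebra_simps)
  then show ?thesis
    by (simp add: power_mult_distrib[symmetric])
qed

lemma norm_hopf_map: "norm (hopf_map x) = (norm x)\<^sup>2"
proof -
  have "(norm (hopf_map x))\<^sup>2 = ((norm x)\<^sup>2)\<^sup>2"
    unfolding norm_pair_power2[of x]
    by (simp add: norm_pair_power2 hopf_map_eq norm_mult_rcho power_mult_distrib power2_diff power2_sum)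
  then show ?thesis
    by (rule power2_eq_imp_eq) simp_all
qed

lemma continuous_on_hopf_map: "continuous_on A (hopf_map :: 'a::rcho \<times> 'a \<Rightarrow> _)"
proof -
  have "continuous_on UNIV (conjugate :: 'a \<Rightarrow> 'a)"
    by (intro linear_continuous_on) (simp add: linear_conjugate flip: linear_conv_bounded_linear)
  then have "continuous_on A (\<lambda>x. conjugate (snd x :: 'a))"
    by (rule continuous_on_compose2) (intro continuous_intros, simp)
  then show ?thesis
    unfolding hopf_map_eq[abs_def]
    by (intro continuous_intros bounded_bilinear.continuous_on[OF bounded_bilinear_mult_rcho])
qed

text \<open>With e = (1, 0) and w = u + e, the Clifford relation gives A_w A_e A_w = 2 (w . e) A_w -
  |w|^2 A_e. For unit u one has 2 (w . e) = |w|^2, so the right side is |w|^2 A_u. The proof checks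
  this on quadratic forms in coordinates.\<close>

lemma hopf_map_hopf_op:
  fixes x :: "'k::rcho \<times> 'k"
  assumes "norm u = 1"
  shows "inner (hopf_map (hopf_op (u + (1, 0)) x)) (1, 0)
    = (norm (u + (1, 0)))\<^sup>2 * inner (hopf_map x) u"
proof -
  obtain r q where u: "u = (r, q)"
    by (cases u)
  obtain a b where x: "x = (a, b)"
    by (cases x)
  have "(norm q)\<^sup>2 = 1 - r\<^sup>2"
    using norm_pair_power2[of u] assms by (simp add: u)
  then show ?thesis
    by (simp add: norm_pair_power2 u x hopf_map_eq hopf_op_def norm_plus_power2 norm_minus_power2
        norm_mult_rcho inner_conjugate_mult inner_mult_conjugate power_mult_distrib)
      (simp add: algebra_simps power2_eq_square)
qed

lemma integral_hopf_power_unit: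
  fixes u :: "real \<times> 'k::rcho"
  assumes "norm u = 1"
  shows "(\<integral>x. inner (hopf_map x) u ^ j \<partial>sphere_measure)
    = (\<integral>x. inner (hopf_map x) (1, 0 :: 'k) ^ j \<partial>sphere_measure)"
proof -
  have *: ?thesis if "linear_isometry T" "\<And>x. inner (hopf_map (T x)) (1, 0) = inner (hopf_map x) u"
    for T :: "'k \<times> 'k \<Rightarrow> 'k \<times> 'k"
  proof -
    have "(\<integral>x. inner (hopf_map (T x)) (1, 0) ^ j \<partial>sphere_measure)
        = (\<integral>x. inner (hopf_map x) (1, 0 :: 'k) ^ j \<partial>sphere_measure)"
      by (rule linear_isometry.integral_sphere_measure_isometry[OF that(1),
            where f="\<lambda>x. inner (hopf_map x) (1, 0 :: 'k) ^ j"])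
        (intro borel_measurable_continuous_onI continuous_intros continuous_on_hopf_map)
    then show ?thesis
      by (simp only: that(2))
  qed
  show ?thesis
  \<comment> \<open>At the antipode of (1, 0) the intertwining operator vanishes; swapping the two
    coordinates, which negates the first component of the Hopf map, takes its place.\<close>
  proof (cases "u + (1, 0) = 0")
    case True
    then have u: "u = (- 1, 0)"
      by (cases u) (auto simp: zero_prod_def)
    show ?thesis
    proof (rule *)
      show "linear_isometry (prod.swap :: 'k \<times> 'k \<Rightarrow> _)"
        by (intro linear_isometry_endo linearI) (auto simp: norm_prod_def add.commute)
    qed (simp add: u hopf_map_eq)
  next
    case False
    let ?w = "u + (1, 0)"
    show ?thesis
    proof (rule *)
      show "linear_isometry (\<lambda>x. hopf_op ?w x /\<^sub>R norm ?w)"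
        using False
        by (intro linear_isometry_endo linear_compose_scale_right linear_hopf_op) (simp add: norm_hopf_op)
      have scale: "inner (hopf_map (c *\<^sub>R x)) (1, 0) = c\<^sup>2 * inner (hopf_map x) (1, 0)"
        for c and x :: "'k \<times> 'k"
        by (simp add: hopf_map_eq power_mult_distrib right_diff_distrib)
      show "inner (hopf_map (hopf_op ?w x /\<^sub>R norm ?w)) (1, 0) = inner (hopf_map x) u" for x
        unfolding scale hopf_map_hopf_op[OF assms] using False by (simp add: power_inverse)
    qed
  qed
qed

text \<open>Independence of the direction of u leaves one unknown constant \<open>?C\<close>.
  Averaging over unit u and exchanging the integrals determines it: with x fixed,
  \<open>hopf_map x\<close> is a unit vector, so the integral over u is the moment of the target
  sphere.\<close>

lemma integral_hopf_power:
  fixes u :: "real \<times> 'k::rcho"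
  shows "(\<integral>x. inner (hopf_map x) u ^ j \<partial>sphere_measure) = (\<integral>y. inner y u ^ j \<partial>sphere_measure)"
proof -
  let ?C = "\<integral>x. inner (hopf_map x) (1, 0) ^ j \<partial>(sphere_measure :: ('k \<times> 'k) measure)"
  have C: "(\<integral>x. inner (hopf_map x) u ^ j \<partial>sphere_measure) = ?C * norm u ^ j" for u :: "real \<times> 'k"
  proof -
    obtain v :: "real \<times> 'k" where v: "norm v = 1" "u = norm u *\<^sub>R v"
    proof (cases "u = 0")
      case True
      then show ?thesis
        using that[of "(1, 0)"] by (simp add: zero_prod_def)
    next
      case False
      then show ?thesis
        using that[of "u /\<^sub>R norm u"] by simp
    qed
    have "(\<integral>x. inner (hopf_map x) (c *\<^sub>R v) ^ j \<partial>sphere_measure) = ?C * c ^ j" for c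
      unfolding inner_scaleR_right power_mult_distrib integral_mult_right_zero
        integral_hopf_power_unit[OF v(1)] by simp
    from this[of "norm u"] show ?thesis
      unfolding v(2)[symmetric] .
  qed
  have "?C = (\<integral>u. ?C \<partial>(sphere_measure :: (real \<times> 'k) measure))"
    by (simp only: lebesgue_integral_const sphere_measure.prob_space scaleR_one)
  also have "\<dots> = (\<integral>u. ?C * norm u ^ j \<partial>(sphere_measure :: (real \<times> 'k) measure))"
    by (rule integral_sphere_cong) simp
  also have "\<dots> = (\<integral>u. (\<integral>x. inner (hopf_map x) u ^ j \<partial>sphere_measure)
      \<partial>(sphere_measure :: (real \<times> 'k) measure))"
    by (rule integral_sphere_cong) (rule C[symmetric])
  also have "\<dots> = (\<integral>x. (\<integral>u. inner (hopf_map x) u ^ j \<partial>sphere_measure)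
      \<partial>(sphere_measure :: ('k \<times> 'k) measure))"
  proof (rule sphere_measure_Fubini)
    have "continuous_on UNIV (\<lambda>p :: ('k \<times> 'k) \<times> (real \<times> 'k). hopf_map (fst p))"
      by (rule continuous_on_compose2[OF continuous_on_hopf_map[of UNIV]]) (intro continuous_intros, simp)
    then show "continuous_on UNIV (\<lambda>(x :: 'k \<times> 'k, u). inner (hopf_map x) u ^ j)"
      unfolding split_def by (intro continuous_intros)
  qed
  also have "\<dots> = (\<integral>x. sphere_moment TYPE(real \<times> 'k) j \<partial>(sphere_measure :: ('k \<times> 'k) measure))"
    by (rule integral_sphere_cong)
      (subst inner_commute, simp add: integral_sphere_power norm_hopf_map)
  also have "\<dots> = sphere_moment TYPE(real \<times> 'k) j"
    by (simp add: sphere_measure.prob_space)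
  finally have "?C = sphere_moment TYPE(real \<times> 'k) j" .
  then show ?thesis
    by (intro trans[OF C]) (simp only: integral_sphere_power)
qed

lemma polys_hopf:
  assumes "p \<in> polys t"
  shows "(\<lambda>x. p (hopf_map x)) \<in> polys (2 * t)"
    and "(\<integral>x. p (hopf_map x) \<partial>sphere_measure) = integral\<^sup>L sphere_measure p"
proof -
  show "(\<lambda>x. p (hopf_map x)) \<in> polys (2 * t)"
    using assms
  proof (induction rule: polys_induct)
    case (pow j u)
    have "(\<lambda>x. inner (hopf_map x) u ^ j) \<in> polys (2 * j)"
      unfolding inner_hopf_map by (intro polys_power polys_quadratic_form linear_hopf_op)
    with pow show ?case
      by (auto intro: polys_mono)
  qed (auto intro: polys_add polys_scale)
  show "(\<integral>x. p (hopf_map x) \<partial>sphere_measure) = integral\<^sup>L sphere_measure p"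
    using assms
  proof (induction rule: polys_induct)
    case (pow j u)
    show ?case
      by (rule integral_hopf_power)
  next
    case (add f g)
    have cont: "continuous_on UNIV (\<lambda>x. f (hopf_map x))" "continuous_on UNIV (\<lambda>x. g (hopf_map x))"
      using add.hyps
      by (auto intro!: continuous_on_compose2[OF polys_continuous_on continuous_on_hopf_map])
    show ?case
      using add.hyps add.IH
      by (simp add: integrable_sphere_measure cont polys_continuous_on)
  qed simp
qed

section \<open>Fibre averages for the Hopf map\<close>

definition pair_adj :: "'k::rcho \<times> 'k \<Rightarrow> 'k \<times> 'k \<Rightarrow> 'k" where
  "pair_adj x u = conjugate (fst x) * fst u + conjugate (snd x) * snd u"

lemma norm_pair_rmult: "norm (pair_rmult x z) = norm x * norm z"
proof -
  have "(norm (pair_rmult x z))\<^sup>2 = (norm x * norm z)\<^sup>2"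
    by (simp add: norm_pair_power2 pair_rmult_def norm_mult_rcho power_mult_distrib distrib_right)
  then show ?thesis
    by (rule power2_eq_imp_eq) simp_all
qed

lemma inner_pair_rmult: "inner (pair_rmult x z) u = inner z (pair_adj x u)"
  by (simp add: inner_prod_def pair_rmult_def pair_adj_def inner_mult_right_rcho inner_add_right)

lemma bounded_bilinear_pair_rmult: "bounded_bilinear (pair_rmult :: 'k::rcho \<times> 'k \<Rightarrow> 'k \<Rightarrow> 'k \<times> 'k)"
proof
  show "\<exists>K. \<forall>x z. norm (pair_rmult x z :: 'k \<times> 'k) \<le> norm x * norm z * K"
    by (rule exI[of _ 1]) (simp add: norm_pair_rmult)
qed (simp_all add: pair_rmult_def rcho_add_mult rcho_mult_add rcho_scaleR_mult rcho_mult_scaleR)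

lemma integral_hopf_quadratic:
  fixes u :: "'k::rcho \<times> 'k"
  shows "sphere_moment TYPE('k) (2 * m)
      * (\<integral>x. (((norm u)\<^sup>2 + inner (hopf_map x) (hopf_map u)) / 2) ^ m \<partial>sphere_measure)
    = (\<integral>x. (x \<bullet> u) ^ (2 * m) \<partial>sphere_measure)"
proof -
  let ?q = "\<lambda>(v :: 'k \<times> 'k) (y :: real \<times> 'k). (((norm u)\<^sup>2 + inner y (hopf_map v)) / 2) ^ m"
  obtain e :: 'k where "norm e = 1"
    by (metis norm_Basis nonempty_Basis ex_in_conv)
  \<comment> \<open>With first component 0 there is no triple product: for unit x both |x* v|^2 and
    the Hopf expression equal |u|^2 |snd x|^2.\<close>
  define v where "v = (0 :: 'k, norm u *\<^sub>R e)"
  have v: "norm v = norm u"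
    using \<open>norm e = 1\<close> by (simp add: v_def norm_prod_def)
  have polys_q: "?q v \<in> polys m" for v
  proof -
    have "(\<lambda>y. ((norm u)\<^sup>2 + inner y (hopf_map v)) / 2) \<in> polys 1"
      using polys_scale[OF polys_add[OF polys_const polys_inner_power[of 1 1]], of "1 / 2"] by simp
    from polys_power[OF this, of m] show ?thesis
      by simp
  qed
  have hv: "norm (hopf_map v) = norm (hopf_map u)"
    by (simp add: norm_hopf_map v)
  \<comment> \<open>The vectors \<open>hopf_map v\<close> and \<open>hopf_map u\<close> have equal
    norm. Since polynomials have the same integral before and after pullback by the Hopf map, a
    reflection of the target can relate the two integrals.\<close>
  obtain T :: "real \<times> 'k \<Rightarrow> real \<times> 'k" where T: "linear_isometry T"
      "\<And>y. inner (T y) (hopf_map v) = inner y (hopf_map u)"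
    using reflection[OF hv] by blast
  have "(\<integral>x. ?q u (hopf_map x) \<partial>sphere_measure) = (\<integral>y. ?q v (T y) \<partial>sphere_measure)"
    unfolding polys_hopf(2)[OF polys_q] T(2) ..
  also have "\<dots> = (\<integral>y. ?q v y \<partial>sphere_measure)"
    by (rule linear_isometry.integral_sphere_measure_isometry[OF T(1)])
      (rule borel_measurable_continuous_onI[OF polys_continuous_on[OF polys_q]])
  also have "\<dots> = (\<integral>x. ?q v (hopf_map x) \<partial>sphere_measure)"
    by (rule polys_hopf(2)[OF polys_q, symmetric])
  also have "\<dots> = (\<integral>x. norm (pair_adj x v) ^ (2 * m) \<partial>sphere_measure)"
  proof (rule integral_sphere_cong)
    fix x :: "'k \<times> 'k" assume "norm x = 1"
    then have "(norm (fst x))\<^sup>2 = 1 - (norm (snd x))\<^sup>2"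
      using norm_pair_power2[of x] by simp
    then have "((norm u)\<^sup>2 + inner (hopf_map x) (hopf_map v)) / 2
        = (norm (pair_adj x v))\<^sup>2"
      using \<open>norm e = 1\<close>
      by (simp add: v_def pair_adj_def hopf_map_eq norm_mult_rcho power_mult_distrib) (simp add: algebra_simps)
    then show "?q v (hopf_map x) = norm (pair_adj x v) ^ (2 * m)"
      by (simp add: power_mult)
  qed
  finally have "sphere_moment TYPE('k) (2 * m) * (\<integral>x. ?q u (hopf_map x) \<partial>sphere_measure)
    = (\<integral>x. (x \<bullet> v) ^ (2 * m) \<partial>sphere_measure)"
    using integral_fibre_averages[OF bounded_bilinear_pair_rmult norm_pair_rmult inner_pair_rmult,
        where j="2 * m" and u=v]
    by simp
  then show ?thesis
    by (simp add: v integral_sphere_power)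
qed

text \<open>Invariance says (a \<zeta>) conj(b \<zeta>) = |\<zeta>|^2 a conj(b), first for units and
  then by scaling for all \<zeta>. Right multiplication by b \<zeta> cancels the conjugate and gives
  (a conj(b)) (b \<zeta>) = |b|^2 a \<zeta>. Taking \<zeta> = conj(b) d yields the associativity
  needed to turn the cross term (conj(a) c) . (conj(b) d) of the expanded norm into (a conj(b)) . (c
  conj(d)).\<close>

lemma norm_pair_adj_power2:
  assumes "\<forall>\<zeta>\<in>sphere 0 1. hopf_map (pair_rmult z \<zeta>) = hopf_map z"
  shows "(norm (pair_adj z u))\<^sup>2 = ((norm z)\<^sup>2 * (norm u)\<^sup>2 + inner (hopf_map z) (hopf_map u)) / 2"
proof -
  obtain a b c d where z: "z = (a, b)" and u: "u = (c, d)"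
    by (metis surj_pair)
  have unit: "(a * \<zeta>) * conjugate (b * \<zeta>) = a * conjugate b" if "norm \<zeta> = 1" for \<zeta>
    using bspec[OF assms, of \<zeta>] that by (simp add: z pair_rmult_def hopf_map_eq)
  have "(a * \<zeta>) * conjugate (b * \<zeta>) = (norm \<zeta>)\<^sup>2 *\<^sub>R (a * conjugate b)" for \<zeta>
  proof (cases "\<zeta> = 0")
    case False
    have "(a * \<zeta>) * conjugate (b * \<zeta>)
        = (norm \<zeta>)\<^sup>2 *\<^sub>R ((a * (\<zeta> /\<^sub>R norm \<zeta>)) * conjugate (b * (\<zeta> /\<^sub>R norm \<zeta>)))"
      using False
      by (simp add: rcho_mult_scaleR rcho_scaleR_mult conjugate_scaleR power2_eq_square field_simps)
    with unit[of "\<zeta> /\<^sub>R norm \<zeta>"] False show ?thesis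
      by simp
  qed simp
  then have "(norm \<zeta>)\<^sup>2 *\<^sub>R ((a * conjugate b) * (b * \<zeta>)) = (norm (b * \<zeta>))\<^sup>2 *\<^sub>R (a * \<zeta>)" for \<zeta>
    by (metis mult_conjugate_cancel(3) rcho_scaleR_mult)
  then have "(norm \<zeta>)\<^sup>2 *\<^sub>R ((a * conjugate b) * (b * \<zeta>)) = (norm \<zeta>)\<^sup>2 *\<^sub>R ((norm b)\<^sup>2 *\<^sub>R (a * \<zeta>))" for \<zeta>
    by (simp add: norm_mult_rcho power_mult_distrib mult.commute)
  then have b\<zeta>: "(a * conjugate b) * (b * \<zeta>) = (norm b)\<^sup>2 *\<^sub>R (a * \<zeta>)" for \<zeta>
    by (cases "\<zeta> = 0") (simp, metis norm_eq_zero power_eq_0_iff scaleR_cancel_left)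
  have assoc: "(a * conjugate b) * d = a * (conjugate b * d)"
  proof (cases "b = 0")
    case False
    have "(norm b)\<^sup>2 *\<^sub>R ((a * conjugate b) * d) = (norm b)\<^sup>2 *\<^sub>R (a * (conjugate b * d))"
      using b\<zeta>[of "conjugate b * d"] by (simp add: mult_conjugate_cancel rcho_mult_scaleR)
    with False show ?thesis
      by simp
  qed simp
  have "inner (conjugate a * c) (conjugate b * d) = inner c (a * (conjugate b * d))"
    by (rule inner_conjugate_mult)
  also have "\<dots> = inner ((a * conjugate b) * d) c"
    by (simp add: assoc inner_commute)
  also have "\<dots> = inner (a * conjugate b) (c * conjugate d)"
    by (rule inner_mult_left_rcho)
  finally show ?thesis
    by (simp add: z u pair_adj_def norm_plus_power2 norm_pair_power2 hopf_map_eq norm_mult_rcho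
        power_mult_distrib algebra_simps)
qed

section \<open>The projective map\<close>

lemma fibration_hopf:
  "fibration (pair_rmult :: 'k::rcho \<times> 'k \<Rightarrow> _) pair_adj hopf_map sphere_measure sphere_polys"
proof
  fix f :: "real \<times> 'k \<Rightarrow> real" and s
  assume "f \<in> sphere_polys s"
  then obtain p where p: "p \<in> polys s" and f: "\<And>y. norm y = 1 \<Longrightarrow> f y = p y"
    by (auto simp: sphere_polys_def)
  have fp: "f (hopf_map x) = p (hopf_map x)" if "norm x = 1" for x
    using f[of "hopf_map x"] that by (simp add: norm_hopf_map)
  with polys_hopf(1)[OF p] show "(\<lambda>x. f (hopf_map x)) \<in> sphere_polys (2 * s)"
    by (auto simp: sphere_polys_def)
  have "(\<integral>x. f (hopf_map x) \<partial>sphere_measure) = (\<integral>x. p (hopf_map x) \<partial>sphere_measure)"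
    by (rule integral_sphere_cong[OF fp])
  also have "\<dots> = integral\<^sup>L sphere_measure f"
    unfolding polys_hopf(2)[OF p] by (rule integral_sphere_cong) (simp add: f)
  finally show "(\<integral>x. f (hopf_map x) \<partial>sphere_measure) = integral\<^sup>L sphere_measure f" .
next
  fix u :: "'k \<times> 'k"
  \<comment> \<open>The formula of \<open>norm_pair_adj_power2\<close> at |z| = 1. It is affine in
    the point of the target, so its m-th power has degree m.\<close>
  let ?g = "\<lambda>y. ((norm u)\<^sup>2 + inner y (hopf_map u)) / 2"
  have "?g \<in> polys 1"
    using polys_scale[OF polys_add[OF polys_const polys_inner_power[of 1 1]], of "1 / 2"] by simp
  then have g: "(\<lambda>y. ?g y ^ m) \<in> sphere_polys m" for m
    using polys_power[of ?g 1 m] by (simp add: polys_imp_sphere_polys)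
  have adj: "(norm (pair_adj z u))\<^sup>2 = ?g (hopf_map z)"
    if "norm z = 1" "\<forall>\<zeta>\<in>sphere 0 1. hopf_map (pair_rmult z \<zeta>) = hopf_map z" for z
    using norm_pair_adj_power2[OF that(2), of u] that(1) by simp
  show "\<exists>g. (\<forall>m. (\<lambda>y. g y ^ m) \<in> sphere_polys m) \<and>
      (\<forall>z\<in>sphere 0 1. (\<forall>\<zeta>\<in>sphere 0 1. hopf_map (pair_rmult z \<zeta>) = hopf_map z) \<longrightarrow>
        (norm (pair_adj z u))\<^sup>2 = g (hopf_map z)) \<and>
      (\<forall>m. sphere_moment TYPE('k) (2 * m) * (\<integral>x. g (hopf_map x) ^ m \<partial>sphere_measure)
        = (\<integral>x. (x \<bullet> u) ^ (2 * m) \<partial>sphere_measure))"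
    by (intro exI[of _ ?g] conjI allI ballI impI g adj integral_hopf_quadratic) simp_all
qed (simp_all add: norm_pair_rmult inner_pair_rmult prob_space_sphere_measure sphere_polys_const
    sphere_polys_mono)

lemma hopf_map_pair_rmult:
  fixes z :: "'k::rcho \<times> 'k"
  assumes "DIM('k) \<noteq> 8" "norm \<zeta> = 1"
  shows "hopf_map (pair_rmult z \<zeta>) = hopf_map z"
  using assms(2)
  by (simp add: hopf_map_eq pair_rmult_def norm_mult_rcho conjugate_mult mult_assoc_rcho[OF assms(1)]
      mult_conjugate_cancel)

section \<open>Classes of the projective map as fibres\<close>

definition vec_adj :: "'k::rcho ^ 'n \<Rightarrow> 'k ^ 'n \<Rightarrow> 'k" where
  "vec_adj x u = (\<Sum>i\<in>UNIV. conjugate (x $ i) * u $ i)"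

lemma norm_vec_power2: "(norm x)\<^sup>2 = (\<Sum>i\<in>UNIV. (norm (x $ i))\<^sup>2)" for x :: "'k::real_inner ^ 'n"
  by (simp add: power2_norm_eq_inner inner_vec_def)

lemma norm_vec_rmult: "norm (vec_rmult x z) = norm x * norm z"
proof -
  have "(norm (vec_rmult x z))\<^sup>2 = (norm x * norm z)\<^sup>2"
    by (simp add: norm_vec_power2 vec_rmult_def norm_mult_rcho power_mult_distrib sum_distrib_right)
  then show ?thesis
    by (rule power2_eq_imp_eq) simp_all
qed

lemma inner_vec_rmult: "inner (vec_rmult x z) u = inner z (vec_adj x u)"
  by (simp add: inner_vec_def vec_rmult_def vec_adj_def inner_mult_right_rcho inner_sum_right)

lemma bounded_bilinear_vec_rmult:
  "bounded_bilinear (vec_rmult :: 'k::rcho ^ 'n \<Rightarrow> 'k \<Rightarrow> 'k ^ 'n)"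
proof
  show "\<exists>K. \<forall>x z. norm (vec_rmult x z :: 'k ^ 'n) \<le> norm x * norm z * K"
    by (rule exI[of _ 1]) (simp add: norm_vec_rmult)
qed (simp_all add: vec_rmult_def vec_eq_iff rcho_add_mult rcho_mult_add rcho_scaleR_mult
    rcho_mult_scaleR)

lemma vec_rmult_assoc:
  "DIM('k) \<noteq> 8 \<Longrightarrow> vec_rmult (vec_rmult x y) z = vec_rmult x (y * z)" for x :: "'k::rcho ^ 'n"
  by (simp add: vec_rmult_def vec_eq_iff mult_assoc_rcho)

text \<open>With associativity the unit \<open>conjugate l /\<^sub>R norm l\<close> is absorbed into
  \<zeta>, and left multiplication by it permutes the unit sphere.\<close>

lemma proj_map_assoc:
  fixes x :: "'k::rcho ^ 'n::{finite,linorder}"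
  assumes dim: "DIM('k) \<noteq> 8"
  shows "proj_map x = vec_rmult x ` sphere 0 1"
proof (cases "x $ Max UNIV = 0")
  case False
  define l where "l = x $ Max UNIV"
  have l: "norm l \<noteq> 0"
    using False by (simp add: l_def)
  have eq: "vec_rmult (vec_rmult x (conjugate l)) \<zeta> /\<^sub>R norm l
      = vec_rmult x ((conjugate l * \<zeta>) /\<^sub>R norm l)" for \<zeta>
    by (simp add: vec_rmult_assoc[OF dim] bounded_bilinear.scaleR_right[OF bounded_bilinear_vec_rmult])
  have "\<zeta> \<in> (\<lambda>\<zeta>. (conjugate l * \<zeta>) /\<^sub>R norm l) ` sphere 0 1" if "norm \<zeta> = 1" for \<zeta>
    using that l
    by (intro image_eqI[of _ _ "(l * \<zeta>) /\<^sub>R norm l"])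
      (simp_all add: norm_mult_rcho rcho_mult_scaleR mult_conjugate_cancel power2_eq_square field_simps)
  then have "sphere 0 1 = (\<lambda>\<zeta>. (conjugate l * \<zeta>) /\<^sub>R norm l) ` sphere 0 1"
    using l by (auto simp: norm_mult_rcho)
  then have "vec_rmult x ` sphere 0 1 = vec_rmult x ` (\<lambda>\<zeta>. (conjugate l * \<zeta>) /\<^sub>R norm l) ` sphere 0 1"
    by (rule arg_cong)
  with False show ?thesis
    by (simp add: proj_map_def eq flip: l_def) (auto simp: l_def)
qed (auto simp: proj_map_def)

text \<open>The coordinate norms and the products with the conjugate of the last coordinate are
  invariants of a class, and together they determine it. Multiplying by \<open>conjugate ?l\<close>
  before \<zeta> is what makes this work without associativity.\<close>

lemma proj_map_nonzero:
  fixes \<omega> :: "'k::rcho ^ 'n::{finite,linorder}"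
  assumes "x \<in> proj_map \<omega>" "\<omega> $ Max UNIV \<noteq> 0"
  shows "norm (x $ i) = norm (\<omega> $ i)"
    and "x $ i * conjugate (x $ Max UNIV) = \<omega> $ i * conjugate (\<omega> $ Max UNIV)"
    and "proj_map x = proj_map \<omega>"
proof -
  let ?l = "\<omega> $ Max UNIV"
  from assms obtain \<zeta> where \<zeta>: "norm \<zeta> = 1"
      and x: "x = vec_rmult (vec_rmult \<omega> (conjugate ?l)) \<zeta> /\<^sub>R norm ?l"
    by (auto simp: proj_map_def Let_def)
  have l: "norm ?l \<noteq> 0"
    using assms by simp
  have xi: "x $ i = ((\<omega> $ i * conjugate ?l) * \<zeta>) /\<^sub>R norm ?l" for i
    by (simp add: x vec_rmult_def)
  show norm: "norm (x $ i) = norm (\<omega> $ i)" for i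
    using l by (simp add: xi norm_mult_rcho \<zeta>)
  \<comment> \<open>As ?l conj(?l) is a real scalar, the last coordinate of x reveals \<zeta>, and
    cancelling \<zeta> against its conjugate gives the second invariant.\<close>
  have xl: "x $ Max UNIV = norm ?l *\<^sub>R \<zeta>"
    using l by (simp add: xi mult_conjugate_mult power2_eq_square)
  show conj: "x $ i * conjugate (x $ Max UNIV) = \<omega> $ i * conjugate ?l" for i
    using l
    by (subst xl, subst xi) (simp add: conjugate_scaleR rcho_mult_scaleR rcho_scaleR_mult
      mult_conjugate_cancel \<zeta>)
  then have "vec_rmult x (conjugate (x $ Max UNIV)) = vec_rmult \<omega> (conjugate ?l)"
    by (simp add: vec_rmult_def)
  moreover have "x $ Max UNIV \<noteq> 0"
    using norm[of "Max UNIV"] l by (metis norm_zero)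
  ultimately show "proj_map x = proj_map \<omega>"
    using l norm[of "Max UNIV"] unfolding proj_map_def Let_def by simp
qed

text \<open>If the last coordinate l is nonzero, \<zeta> = l / |l| undoes the multiplication by
  conj(l); otherwise a right unit is needed.\<close>

lemma proj_map_self:
  fixes x :: "'k::rcho ^ 'n::{finite,linorder}"
  shows "x \<in> proj_map x"
proof (cases "x $ Max UNIV = 0")
  case True
  obtain e :: 'k where e: "norm e = 1" "\<And>x. x * e = x"
    using rcho_right_one by blast
  have "vec_rmult x e = x"
    by (simp add: vec_rmult_def vec_eq_iff e(2))
  then have "x = vec_rmult x e \<and> e \<in> sphere 0 1"
    using e(1) by simp
  with True show ?thesis
    unfolding proj_map_def Let_def by (simp only: if_False simp_thms mem_Collect_eq) (rule exI[of _ e])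
next
  case False
  let ?l = "x $ Max UNIV"
  have "vec_rmult (vec_rmult x (conjugate ?l)) (?l /\<^sub>R norm ?l) /\<^sub>R norm ?l = x"
    using False
    by (simp add: vec_eq_iff vec_rmult_def rcho_mult_scaleR mult_conjugate_cancel power2_eq_square
        field_simps)
  moreover have "?l /\<^sub>R norm ?l \<in> sphere 0 1"
    using False by simp
  ultimately have "\<exists>\<zeta>. x = vec_rmult (vec_rmult x (conjugate ?l)) \<zeta> /\<^sub>R norm ?l \<and> \<zeta> \<in> sphere 0 1"
    by (intro exI[of _ "?l /\<^sub>R norm ?l"] conjI) simp_all
  with False show ?thesis
    unfolding proj_map_def Let_def by (subst if_P) (assumption, rule CollectI)
qed

text \<open>Over the octonions there are only two coordinates. With the last one zero, the class is
  the whole unit sphere in the other coordinate and hence the same for all its members. In the other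
  algebras the factor \<zeta> is absorbed by associativity.\<close>

lemma proj_map_zero:
  fixes \<omega> :: "'k::rcho ^ 'n::{finite,linorder}"
  assumes "x \<in> proj_map \<omega>" "\<omega> $ Max UNIV = 0" "norm \<omega> = 1" "DIM('k) = 8 \<longrightarrow> CARD('n) = 2"
  shows "norm x = 1" "proj_map x = proj_map \<omega>"
proof -
  have proj0: "proj_map y = vec_rmult y ` sphere 0 1" if "y $ Max UNIV = 0" for y :: "('k, 'n) vec"
    using that by (auto simp: proj_map_def)
  obtain \<zeta> where \<zeta>: "norm \<zeta> = 1" and x: "x = vec_rmult \<omega> \<zeta>"
    using assms(1) by (auto simp: proj0 assms(2))
  then have x0: "x $ Max UNIV = 0"
    by (simp add: vec_rmult_def assms(2))
  show x1: "norm x = 1"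
    by (simp add: x norm_vec_rmult \<zeta> assms(3))
  show "proj_map x = proj_map \<omega>"
  proof (cases "DIM('k) = 8")
    case True
    with assms(4) have "card (UNIV - {Max UNIV :: 'n}) = 1"
      by (simp add: card_Diff_singleton)
    then obtain i where i: "UNIV - {Max UNIV :: 'n} = {i}"
      by (rule card_1_singletonE)
    have proj: "proj_map y = {v. v $ Max UNIV = 0 \<and> norm v = 1}"
      if y: "y $ Max UNIV = 0" "norm y = 1" for y :: "('k, 'n) vec"
    proof (intro equalityI subsetI)
      fix v :: "('k, 'n) vec" assume v: "v \<in> {v. v $ Max UNIV = 0 \<and> norm v = 1}"
      have norm_i: "norm (w $ i) = norm w" if "w $ Max UNIV = 0" for w :: "('k, 'n) vec"
      proof -
        have "(norm w)\<^sup>2 = (norm (w $ i))\<^sup>2"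
          unfolding norm_vec_power2[of w]
          by (subst sum.remove[of UNIV "Max UNIV"]) (simp_all add: that i)
        then show ?thesis
          by (rule power2_eq_imp_eq[symmetric]) simp_all
      qed
      \<comment> \<open>The scalar conj(y_i) v_i works because y_i (conj(y_i) v_i) = |y_i|^2 v_i and
        y_i is a unit.\<close>
      have "v = vec_rmult y (conjugate (y $ i) * v $ i)"
      proof (rule vec_eq_iff[THEN iffD2], rule allI)
        fix k :: 'n
        have "k \<in> insert (Max UNIV) (UNIV - {Max UNIV})"
          by blast
        then have "k = Max UNIV \<or> k = i"
          unfolding i by simp
        moreover have "norm (y $ i) = 1" "v $ Max UNIV = 0"
          using v y norm_i[of y] by simp_all
        ultimately show "v $ k = vec_rmult y (conjugate (y $ i) * v $ i) $ k"
          by (auto simp: vec_rmult_def mult_conjugate_cancel y(1))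
      qed
      moreover have "conjugate (y $ i) * v $ i \<in> sphere 0 1"
        using v y by (simp add: norm_mult_rcho norm_i)
      ultimately show "v \<in> proj_map y"
        unfolding proj0[OF y(1)] by (rule image_eqI)
    qed (auto simp: proj0[OF y(1)] norm_vec_rmult y(2), simp add: vec_rmult_def y(1))
    show ?thesis
      using proj[OF x0 x1] proj[OF assms(2,3)] by simp
  next
    case False
    have "\<xi> \<in> (*) \<zeta> ` sphere 0 1" if "norm \<xi> = 1" for \<xi>
      using that \<zeta> by (intro image_eqI[of _ _ "conjugate \<zeta> * \<xi>"])
        (simp_all add: mult_conjugate_cancel norm_mult_rcho)
    then have "sphere 0 1 = (*) \<zeta> ` sphere 0 1"
      using \<zeta> by (auto simp: norm_mult_rcho)
    then have "vec_rmult \<omega> ` sphere 0 1 = vec_rmult \<omega> ` (*) \<zeta> ` sphere 0 1"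
      by (rule arg_cong)
    also have "\<dots> = vec_rmult x ` sphere 0 1"
      by (simp add: image_image x vec_rmult_assoc[OF False])
    finally show ?thesis
      by (simp add: proj0 x0 assms(2))
  qed
qed

lemma proj_map_fibre:
  fixes \<omega> :: "'k::rcho ^ 'n::{finite,linorder}"
  assumes "x \<in> proj_map \<omega>" "norm \<omega> = 1" "DIM('k) = 8 \<longrightarrow> CARD('n) = 2"
  shows "norm x = 1" "proj_map x = proj_map \<omega>"
proof -
  have "norm x = 1 \<and> proj_map x = proj_map \<omega>"
  proof (cases "\<omega> $ Max UNIV = 0")
    case False
    then have "(norm x)\<^sup>2 = (norm \<omega>)\<^sup>2"
      unfolding norm_vec_power2 by (simp add: proj_map_nonzero(1)[OF assms(1)])
    then have "norm x = norm \<omega>"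
      by (rule power2_eq_imp_eq) simp_all
    with False assms show ?thesis
      by (simp add: proj_map_nonzero(3))
  qed (use proj_map_zero assms in blast)
  then show "norm x = 1" "proj_map x = proj_map \<omega>"
    by auto
qed

section \<open>The measure on projective space and descent of functions\<close>

lemma measurable_proj_map:
  "proj_map \<in> measurable sphere_measure (proj_measure :: ('k::rcho ^ 'n::{finite,linorder}) set measure)"
  unfolding proj_measure_def measurable_distr_eq2
  by (rule measurable_measure_of) (auto simp: proj_space_def space_sphere_measure)

text \<open>The target enters \<open>distr\<close> only through its space and measurable sets, so
  the measure can serve as its own target.\<close>

lemma proj_measure_eq: "proj_measure = distr sphere_measure proj_measure proj_map"
  by (subst (1) proj_measure_def) (rule distr_cong, simp_all add: proj_measure_def)

lemma prob_space_proj_measure: "prob_space proj_measure"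
  by (subst proj_measure_eq) (rule sphere_measure.prob_space_distr[OF measurable_proj_map])

lemma space_proj_measure: "space proj_measure = proj_space"
  by (auto simp: proj_measure_def space_measure_of_conv)

lemma integral_proj_measure:
  assumes "f \<in> proj_polys s"
  shows "(\<integral>x. f (proj_map x) \<partial>sphere_measure) = integral\<^sup>L proj_measure f"
proof -
  obtain p where p: "p \<in> polys (2 * s)" and fp: "\<And>x. norm x = 1 \<Longrightarrow> f (proj_map x) = p x"
    using assms by (auto simp: proj_polys_def sphere_polys_def)
  \<comment> \<open>The quotient sigma-algebra reduces measurability of f to that of its pullback,
    which on the sphere is a polynomial.\<close>
  have "f \<in> borel_measurable proj_measure"
  proof (rule measurableI)
    fix B :: "real set" assume "B \<in> sets borel"
    then have "p -` B \<inter> space sphere_measure \<in> sets sphere_measure"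
      using measurable_sphere_measure[OF borel_measurable_continuous_onI[OF polys_continuous_on[OF p]]]
      by (rule measurable_sets[rotated])
    moreover have "proj_map -` (f -` B \<inter> proj_space) \<inter> sphere 0 1 = p -` B \<inter> sphere 0 1"
      by (auto simp: proj_space_def fp)
    ultimately show "f -` B \<inter> space proj_measure \<in> sets proj_measure"
      unfolding space_proj_measure
      by (auto simp: proj_measure_def space_sphere_measure sets_measure_of_conv)
  qed simp
  then show ?thesis
    by (subst proj_measure_eq) (rule integral_distr[OF measurable_proj_map, symmetric])
qed

text \<open>Choosing a representative is harmless: by \<open>proj_map_self\<close> any unit vector
  with the same class as x lies in \<open>proj_map x\<close>, where q is constant.\<close>

lemma descend_to_proj_space:
  fixes q :: "'k::rcho ^ 'n::{finite,linorder} \<Rightarrow> real"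
  assumes q: "q \<in> polys 2" "\<And>x x'. norm x = 1 \<Longrightarrow> x' \<in> proj_map x \<Longrightarrow> q x' = q x"
  obtains g where "\<And>m. (\<lambda>w. g w ^ m) \<in> proj_polys m" "\<And>x. norm x = 1 \<Longrightarrow> g (proj_map x) = q x"
proof
  define g where "g w = q (SOME x. norm x = 1 \<and> proj_map x = w)" for w
  show g: "g (proj_map x) = q x" if x: "norm x = 1" for x
  proof -
    let ?x = "SOME x'. norm x' = 1 \<and> proj_map x' = proj_map x"
    have "norm ?x = 1 \<and> proj_map ?x = proj_map x"
      by (rule someI[of _ x]) (simp add: x)
    then have "?x \<in> proj_map x"
      using proj_map_self[of ?x] by simp
    then show ?thesis
      unfolding g_def by (rule q(2)[OF x])
  qed
  show "(\<lambda>w. g w ^ m) \<in> proj_polys m" for m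
    unfolding proj_polys_def sphere_polys_def using polys_power[OF q(1), of m]
    by (auto simp: g intro!: bexI[of _ "\<lambda>x. q x ^ m"])
qed

text \<open>Translating x by a unit \<zeta> multiplies each term of the adjoint by conj(\<zeta>) on
  the left; associativity lets this factor out of the sum, and its norm is 1.\<close>

lemma quadratic_fibre_average_assoc:
  fixes u :: "'k::rcho ^ 'n::{finite,linorder}"
  assumes dim: "DIM('k) \<noteq> 8"
  defines "q \<equiv> \<lambda>x. (norm (vec_adj x u))\<^sup>2"
  shows "q \<in> polys 2"
    and "\<And>x x'. x' \<in> proj_map x \<Longrightarrow> q x' = q x"
    and "\<And>m. sphere_moment TYPE('k) (2 * m) * (\<integral>x. q x ^ m \<partial>sphere_measure)
      = (\<integral>x. (x \<bullet> u) ^ (2 * m) \<partial>sphere_measure)"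
proof -
  have "linear (\<lambda>x. vec_adj x u)"
    by (intro linearI) (simp_all add: vec_adj_def conjugate_add conjugate_scaleR rcho_add_mult
        rcho_scaleR_mult sum.distrib scaleR_sum_right)
  then show "q \<in> polys 2"
    unfolding q_def by (rule polys_norm_linear_power2)
  show "q x' = q x" if "x' \<in> proj_map x" for x x'
  proof -
    from that obtain \<zeta> where \<zeta>: "norm \<zeta> = 1" and x': "x' = vec_rmult x \<zeta>"
      by (auto simp: proj_map_assoc[OF dim])
    have "vec_adj x' u = conjugate \<zeta> * vec_adj x u"
      by (simp add: x' vec_adj_def vec_rmult_def conjugate_mult mult_assoc_rcho[OF dim]
          bounded_bilinear.sum_right[OF bounded_bilinear_mult_rcho])
    then show ?thesis
      by (simp add: q_def norm_mult_rcho \<zeta>)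
  qed
  show "sphere_moment TYPE('k) (2 * m) * (\<integral>x. q x ^ m \<partial>sphere_measure)
      = (\<integral>x. (x \<bullet> u) ^ (2 * m) \<partial>sphere_measure)" for m
    unfolding q_def power_mult[symmetric]
    by (rule integral_fibre_averages[OF bounded_bilinear_vec_rmult norm_vec_rmult inner_vec_rmult])
qed

section \<open>Two coordinates: the projective line and the Hopf map\<close>

context
  fixes pr :: "'k::rcho ^ 'n::{finite,linorder} \<Rightarrow> 'k \<times> 'k" and i :: 'n
  assumes UNIV2: "UNIV = {i, Max UNIV}" and i: "i \<noteq> Max UNIV"
  defines "pr \<equiv> \<lambda>x. (x $ i, x $ Max UNIV)"
begin

lemma sum_UNIV2: "sum f UNIV = f i + f (Max UNIV)"
  by (subst UNIV2) (use i in simp)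

lemma linear_isometry_pr: "linear_isometry pr"
proof (rule linear_isometry.intro)
  show "linear pr"
    by (intro linearI) (simp_all add: pr_def)
  show "norm (pr x) = norm x" for x
    by (rule power2_eq_imp_eq) (simp_all add: norm_pair_power2 norm_vec_power2 sum_UNIV2 pr_def)
  show "surj pr"
  proof (rule surjI)
    show "pr (\<chi> k. if k = i then fst p else snd p) = p" for p
      using i by (simp add: pr_def)
  qed
qed

lemma vec_adj_pr: "vec_adj x u = pair_adj (pr x) (pr u)"
  by (simp add: vec_adj_def pair_adj_def sum_UNIV2 pr_def)

lemma pr_vec_rmult: "pr (vec_rmult x \<zeta>) = pair_rmult (pr x) \<zeta>"
  by (simp add: pr_def vec_rmult_def pair_rmult_def)

text \<open>The Hopf map is built from the class invariants of \<open>proj_map_nonzero\<close>; at a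
  vanishing last coordinate only the norm of the other coordinate enters.\<close>

lemma hopf_map_pr:
  assumes "x' \<in> proj_map x"
  shows "hopf_map (pr x') = hopf_map (pr x)"
proof (cases "x $ Max UNIV = 0")
  case True
  then obtain \<zeta> where "norm \<zeta> = 1" "x' = vec_rmult x \<zeta>"
    using assms by (auto simp: proj_map_def)
  with True show ?thesis
    by (simp add: hopf_map_eq pr_def vec_rmult_def norm_mult_rcho)
next
  case False
  then show ?thesis
    using proj_map_nonzero[OF assms False] by (simp add: hopf_map_eq pr_def)
qed

text \<open>Since |z* u|^2 need not descend over the octonions, q is the Hopf expression. It is
  constant on classes, agrees with |z* u|^2 at base points whose unit translates keep their class,
  and inherits its integrals through the isometry \<open>pr\<close>.\<close>

lemma quadratic_fibre_average_pr:
  fixes u :: "('k, 'n) vec"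
  defines "q \<equiv> \<lambda>x. ((norm u)\<^sup>2 + inner (hopf_map (pr x)) (hopf_map (pr u))) / 2"
  shows "q \<in> polys 2"
    and "\<And>x x'. x' \<in> proj_map x \<Longrightarrow> q x' = q x"
    and "\<And>z. norm z = 1 \<Longrightarrow> (\<And>\<zeta>. norm \<zeta> = 1 \<Longrightarrow> proj_map (vec_rmult z \<zeta>) = proj_map z) \<Longrightarrow>
      (norm (vec_adj z u))\<^sup>2 = q z"
    and "\<And>m. sphere_moment TYPE('k) (2 * m) * (\<integral>x. q x ^ m \<partial>sphere_measure)
      = (\<integral>x. (x \<bullet> u) ^ (2 * m) \<partial>sphere_measure)"
proof -
  interpret linear_isometry pr
    by (rule linear_isometry_pr)
  define L where "L x = adjoint pr (hopf_op (hopf_map (pr u)) (pr x))" for x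
  have "linear L"
    using linear_compose[OF linear linear_compose[OF linear_hopf_op adjoint_linear[OF linear]]]
    by (simp add: L_def[abs_def] comp_def)
  have "(\<lambda>x. x \<bullet> L x) \<in> polys 2"
    by (rule polys_quadratic_form[OF \<open>linear L\<close>])
  then have "(\<lambda>x. inner (hopf_map (pr x)) (hopf_map (pr u))) \<in> polys 2"
    by (simp add: L_def inner_hopf_map adjoint_works[OF linear])
  from polys_scale[OF polys_add[OF polys_const[of "(norm u)\<^sup>2"] this], of "1 / 2"]
  show "q \<in> polys 2"
    by (simp add: q_def)
  show "q x' = q x" if "x' \<in> proj_map x" for x x'
    using hopf_map_pr[OF that] by (simp add: q_def)
  show "(norm (vec_adj z u))\<^sup>2 = q z"
    if z: "norm z = 1" and good: "\<And>\<zeta>. norm \<zeta> = 1 \<Longrightarrow> proj_map (vec_rmult z \<zeta>) = proj_map z" for z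
  proof -
    have "hopf_map (pair_rmult (pr z) \<zeta>) = hopf_map (pr z)" if "norm \<zeta> = 1" for \<zeta>
      using hopf_map_pr[of "vec_rmult z \<zeta>" z] proj_map_self[of "vec_rmult z \<zeta>"] good[OF that]
      by (simp add: pr_vec_rmult)
    then show ?thesis
      by (simp add: vec_adj_pr norm_pair_adj_power2 norm z q_def)
  qed
  have inner_pr: "inner (pr x) (pr u) = inner x u" for x
    by (simp add: pr_def inner_vec_def sum_UNIV2)
  show "sphere_moment TYPE('k) (2 * m) * (\<integral>x. q x ^ m \<partial>sphere_measure)
      = (\<integral>x. (x \<bullet> u) ^ (2 * m) \<partial>sphere_measure)" for m
  proof -
    let ?q = "\<lambda>p. (((norm u)\<^sup>2 + inner (hopf_map p) (hopf_map (pr u))) / 2) ^ m"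
    have "(\<integral>x. q x ^ m \<partial>sphere_measure) = integral\<^sup>L sphere_measure ?q"
      unfolding q_def
      by (rule integral_sphere_measure_isometry[of ?q])
        (intro borel_measurable_continuous_onI continuous_intros continuous_on_hopf_map, simp)
    moreover have "(\<integral>x. (x \<bullet> u) ^ (2 * m) \<partial>sphere_measure)
        = (\<integral>p. (p \<bullet> pr u) ^ (2 * m) \<partial>sphere_measure)"
      using integral_sphere_measure_isometry[OF measurable_inner_power, of "pr u" "2 * m"]
      by (simp add: inner_pr)
    ultimately show ?thesis
      using integral_hopf_quadratic[of m "pr u"] by (simp add: norm)
  qed
qed

end

lemma fibration_proj:
  assumes dim: "DIM('k) = 8 \<longrightarrow> CARD('n) = 2"
  shows "fibration (vec_rmult :: 'k::rcho ^ 'n::{finite,linorder} \<Rightarrow> _) vec_adj proj_map proj_measure proj_polys"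
proof (rule fibration.intro)
  fix f :: "('k, 'n) vec set \<Rightarrow> real" and s t :: nat
  show "(\<integral>x. f (proj_map x) \<partial>sphere_measure) = integral\<^sup>L proj_measure f" if "f \<in> proj_polys s"
    using that by (rule integral_proj_measure)
  show "(\<lambda>x. f (proj_map x)) \<in> sphere_polys (2 * s)" if "f \<in> proj_polys s"
    using that by (simp add: proj_polys_def comp_def)
  show "f \<in> proj_polys t" if "f \<in> proj_polys s" "s \<le> t"
    using that sphere_polys_mono[of "f \<circ> proj_map" "2 * s" "2 * t"] by (simp add: proj_polys_def)
  show "(\<lambda>_. 1) \<in> (proj_polys 0 :: (('k, 'n) vec set \<Rightarrow> real) set)"
    by (simp add: proj_polys_def comp_def sphere_polys_const)
next
  fix u :: "('k, 'n) vec"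
  have "\<exists>q. q \<in> polys 2 \<and> (\<forall>x x'. x' \<in> proj_map x \<longrightarrow> q x' = q x) \<and>
      (\<forall>z. norm z = 1 \<longrightarrow> (\<forall>\<zeta>. norm \<zeta> = 1 \<longrightarrow> proj_map (vec_rmult z \<zeta>) = proj_map z) \<longrightarrow>
        (norm (vec_adj z u))\<^sup>2 = q z) \<and>
      (\<forall>m. sphere_moment TYPE('k) (2 * m) * (\<integral>x. q x ^ m \<partial>sphere_measure)
        = (\<integral>x. (x \<bullet> u) ^ (2 * m) \<partial>sphere_measure))" (is "\<exists>q. ?P q")
  proof (cases "DIM('k) = 8")
    case False
    show ?thesis
      by (intro exI[of _ "\<lambda>x. (norm (vec_adj x u))\<^sup>2"] conjI allI impI refl
          quadratic_fibre_average_assoc[OF False])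
  next
    case True
    with dim have "card (UNIV - {Max UNIV :: 'n}) = 1"
      by (simp add: card_Diff_singleton)
    then obtain i where "UNIV - {Max UNIV :: 'n} = {i}"
      by (rule card_1_singletonE)
    then have i: "UNIV = {i, Max UNIV}" "i \<noteq> Max UNIV"
      by auto
    show ?thesis
      by (rule exI[of _ "\<lambda>x. ((norm u)\<^sup>2 + inner (hopf_map (x $ i, x $ Max UNIV))
          (hopf_map (u $ i, u $ Max UNIV))) / 2"], intro conjI allI impI quadratic_fibre_average_pr[OF i])
        simp_all
  qed
  then obtain q where q: "?P q" ..
  then obtain g where g: "\<And>m. (\<lambda>w. g w ^ m) \<in> proj_polys m"
      "\<And>x. norm x = 1 \<Longrightarrow> g (proj_map x) = q x"
    using descend_to_proj_space[of q] by blast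
  have "(\<integral>x. g (proj_map x) ^ m \<partial>sphere_measure) = (\<integral>x. q x ^ m \<partial>sphere_measure)" for m
    by (rule integral_sphere_cong) (simp add: g(2))
  with q show "\<exists>g. (\<forall>m. (\<lambda>w. g w ^ m) \<in> proj_polys m) \<and>
      (\<forall>z\<in>sphere 0 1. (\<forall>\<zeta>\<in>sphere 0 1. proj_map (vec_rmult z \<zeta>) = proj_map z) \<longrightarrow>
        (norm (vec_adj z u))\<^sup>2 = g (proj_map z)) \<and>
      (\<forall>m. sphere_moment TYPE('k) (2 * m) * (\<integral>x. g (proj_map x) ^ m \<partial>sphere_measure)
        = (\<integral>x. (x \<bullet> u) ^ (2 * m) \<partial>sphere_measure))"
    by (intro exI[of _ g] conjI allI ballI impI g(1)) (simp_all add: g(2))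
qed (simp_all add: norm_vec_rmult inner_vec_rmult prob_space_proj_measure)

section \<open>Designs for the projective map and the Hopf map\<close>

lemma proj_designs:
  fixes Y :: "('k::rcho ^ 'n::{finite,linorder}) set set"
  assumes dim: "DIM('k) = 8 \<longrightarrow> CARD('n) = 2"
    and Y0: "proj_design 0 Y w\<^sub>Y"
    and Z0: "\<forall>y\<in>Y. sphere_design 0 (Z y) (w\<^sub>Z y)"
    and zb: "\<forall>y\<in>Y. zb y \<in> y"
    and zb8: "DIM('k) = 8 \<longrightarrow> (\<forall>y\<in>Y. \<forall>\<zeta>\<in>sphere 0 1. vec_rmult (zb y) \<zeta> \<in> y)"
    and X: "X = (\<Union>y\<in>Y. {vec_rmult (zb y) z | z. z \<in> Z y})"
    and w: "\<forall>y\<in>Y. \<forall>z\<in>Z y. w (vec_rmult (zb y) z) = w\<^sub>Y y * w\<^sub>Z y z"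
  shows "(sphere_design t X w \<longrightarrow> proj_design (t div 2) Y w\<^sub>Y) \<and>
    (proj_design (t div 2) Y w\<^sub>Y \<and> (\<forall>y\<in>Y. sphere_design t (Z y) (w\<^sub>Z y)) \<longrightarrow>
      sphere_design t X w) \<and>
    ((\<exists>N. \<forall>y\<in>Y. card (Z y) = N) \<longrightarrow>
      (unweighted_sphere_design t X \<longrightarrow> unweighted_proj_design (t div 2) Y) \<and>
      (unweighted_proj_design (t div 2) Y \<and> (\<forall>y\<in>Y. unweighted_sphere_design t (Z y)) \<longrightarrow>
        unweighted_sphere_design t X))"
proof (rule fibration.designs[OF fibration_proj[OF dim] Y0 _ _ _ _ X])
  fix y assume y: "y \<in> Y"
  have "Y \<subseteq> proj_space"
    using Y0 by (simp add: weighted_design_def space_proj_measure)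
  with y obtain \<omega> where \<omega>: "norm \<omega> = 1" "y = proj_map \<omega>"
    by (auto simp: proj_space_def)
  have fibre: "norm x = 1" "proj_map x = y" if "x \<in> y" for x
    using proj_map_fibre[OF _ \<omega>(1) dim, of x] that \<omega>(2) by auto
  show "norm (zb y) = 1" "proj_map (zb y) = y"
    using fibre zb y by auto
  show "proj_map (vec_rmult (zb y) \<zeta>) = y" if \<zeta>: "norm \<zeta> = 1" for \<zeta>
  \<comment> \<open>Over the octonions the translates stay in y by \<open>zb8\<close>; in the
    associative case the fibre is the orbit of its base point.\<close>
  proof (rule fibre(2), cases "DIM('k) = 8")
    case True
    then show "vec_rmult (zb y) \<zeta> \<in> y"
      using zb8 y \<zeta> by simp
  next
    case False
    have "vec_rmult (zb y) \<zeta> \<in> proj_map (zb y)"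
      using \<zeta> by (simp add: proj_map_assoc[OF False])
    then show "vec_rmult (zb y) \<zeta> \<in> y"
      using \<open>proj_map (zb y) = y\<close> by simp
  qed
qed (use Z0 w in auto)

lemma hopf_designs:
  fixes Y :: "(real \<times> 'k::rcho) set"
  assumes Y0: "sphere_design 0 Y w\<^sub>Y"
    and Z0: "\<forall>y\<in>Y. sphere_design 0 (Z y) (w\<^sub>Z y)"
    and zb: "\<forall>y\<in>Y. zb y \<in> sphere 0 1 \<and> hopf_map (zb y) = y"
    and zb8: "DIM('k) = 8 \<longrightarrow> (\<forall>y\<in>Y. \<forall>\<zeta>\<in>sphere 0 1. hopf_map (pair_rmult (zb y) \<zeta>) = y)"
    and X: "X = (\<Union>y\<in>Y. {pair_rmult (zb y) z | z. z \<in> Z y})"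
    and w: "\<forall>y\<in>Y. \<forall>z\<in>Z y. w (pair_rmult (zb y) z) = w\<^sub>Y y * w\<^sub>Z y z"
  shows "(sphere_design t X w \<longrightarrow> sphere_design (t div 2) Y w\<^sub>Y) \<and>
    (sphere_design (t div 2) Y w\<^sub>Y \<and> (\<forall>y\<in>Y. sphere_design t (Z y) (w\<^sub>Z y)) \<longrightarrow>
      sphere_design t X w) \<and>
    ((\<exists>N. \<forall>y\<in>Y. card (Z y) = N) \<longrightarrow>
      (unweighted_sphere_design t X \<longrightarrow> unweighted_sphere_design (t div 2) Y) \<and>
      (unweighted_sphere_design (t div 2) Y \<and> (\<forall>y\<in>Y. unweighted_sphere_design t (Z y)) \<longrightarrow>
        unweighted_sphere_design t X))"
proof (rule fibration.designs[OF fibration_hopf Y0 _ _ _ _ X])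
  show "hopf_map (pair_rmult (zb y) \<zeta>) = y" if "y \<in> Y" "norm \<zeta> = 1" for y \<zeta>
    using that zb zb8 hopf_map_pair_rmult[of \<zeta> "zb y"] by (cases "DIM('k) = 8") auto
qed (use Z0 w zb in auto)

(* The base points z_y are subject to an extra clause when K = O: their right translates by
   units must stay in the fiber.  This is automatic for K = R, C, H; over O it holds for instance
   when the last coordinate of z_y is real, but not for every point of the fiber. *)

theorem theorem1p1:
  shows "
    ((DIM('k) = 8 \<longrightarrow> CARD('n) = 2) \<longrightarrow>
      (\<forall>(Y :: ('k::rcho ^ 'n::{finite,linorder}) set set) w\<^sub>Y (Z :: _ \<Rightarrow> 'k set) w\<^sub>Z zb X w.
        proj_design 0 Y w\<^sub>Y \<and>
        (\<forall>y\<in>Y. sphere_design 0 (Z y) (w\<^sub>Z y)) \<and>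
        (\<forall>y\<in>Y. zb y \<in> y) \<and>
        (DIM('k) = 8 \<longrightarrow> (\<forall>y\<in>Y. \<forall>\<zeta>\<in>sphere 0 1. vec_rmult (zb y) \<zeta> \<in> y)) \<and>
        X = (\<Union>y\<in>Y. {vec_rmult (zb y) z | z. z \<in> Z y}) \<and>
        (\<forall>y\<in>Y. \<forall>z\<in>Z y. w (vec_rmult (zb y) z) = w\<^sub>Y y * w\<^sub>Z y z)
        \<longrightarrow>
        (\<forall>t::nat.
          (sphere_design t X w \<longrightarrow> proj_design (t div 2) Y w\<^sub>Y) \<and>
          (proj_design (t div 2) Y w\<^sub>Y \<and> (\<forall>y\<in>Y. sphere_design t (Z y) (w\<^sub>Z y)) \<longrightarrow>
            sphere_design t X w) \<and>
          ((\<exists>N. \<forall>y\<in>Y. card (Z y) = N) \<longrightarrow>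
            (unweighted_sphere_design t X \<longrightarrow> unweighted_proj_design (t div 2) Y) \<and>
            (unweighted_proj_design (t div 2) Y \<and> (\<forall>y\<in>Y. unweighted_sphere_design t (Z y)) \<longrightarrow>
              unweighted_sphere_design t X)))))
    \<and>
    (\<forall>(Y :: (real \<times> 'k) set) w\<^sub>Y (Z :: _ \<Rightarrow> 'k set) w\<^sub>Z zb X w.
        sphere_design 0 Y w\<^sub>Y \<and>
        (\<forall>y\<in>Y. sphere_design 0 (Z y) (w\<^sub>Z y)) \<and>
        (\<forall>y\<in>Y. zb y \<in> sphere 0 1 \<and> hopf_map (zb y) = y) \<and>
        (DIM('k) = 8 \<longrightarrow> (\<forall>y\<in>Y. \<forall>\<zeta>\<in>sphere 0 1. hopf_map (pair_rmult (zb y) \<zeta>) = y)) \<and>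
        X = (\<Union>y\<in>Y. {pair_rmult (zb y) z | z. z \<in> Z y}) \<and>
        (\<forall>y\<in>Y. \<forall>z\<in>Z y. w (pair_rmult (zb y) z) = w\<^sub>Y y * w\<^sub>Z y z)
        \<longrightarrow>
        (\<forall>t::nat.
          (sphere_design t X w \<longrightarrow> sphere_design (t div 2) Y w\<^sub>Y) \<and>
          (sphere_design (t div 2) Y w\<^sub>Y \<and> (\<forall>y\<in>Y. sphere_design t (Z y) (w\<^sub>Z y)) \<longrightarrow>
            sphere_design t X w) \<and>
          ((\<exists>N. \<forall>y\<in>Y. card (Z y) = N) \<longrightarrow>
            (unweighted_sphere_design t X \<longrightarrow> unweighted_sphere_design (t div 2) Y) \<and>
            (unweighted_sphere_design (t div 2) Y \<and> (\<forall>y\<in>Y. unweighted_sphere_design t (Z y)) \<longrightarrow>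
              unweighted_sphere_design t X))))"
  by (rule conjI; intro impI allI; elim conjE; (rule proj_designs hopf_designs; assumption))

end
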